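(* Let $\lambda>0$, let $\mu,\nu\in P_2(\mathbb{R}^d)$, and let $\varphi:\mathbb{R}^d\to\mathbb{R}$ be such that $(\mu,\nu,\varphi)$ is $\lambda$-regular; let $T=\nabla\varphi$ be the optimal transport map from $\mu$ to $\nu$. Let $\mu_h,\nu_h\in P_2(\mathbb{R}^d)$, and let $X,Y\subset\mathbb{R}^d$ be Borel sets such that $\mu,\mu_h$ are concentrated on $X$ and $\nu,\nu_h$ are concentrated on $Y$. Let $\alpha_h\in\Pi(\mu,\mu_h)$ and $\beta_h\in\Pi(\nu_h,\nu)$ be (arbitrary) transport plans, and set $$e_{\alpha_h}:=\Big(\int_{X^2}|x-x'|^2\,d\alpha_h(x,x')\Big)^{1/2},\qquad e_{\beta_h}:=\Big(\int_{Y^2}|y'-y|^2\,d\beta_h(y',y)\Big)^{1/2},\qquad e_h:=e_{\alpha_h}+e_{\beta_h}.$$ If $\gamma_h\in\Pi(\mu_h,\nu_h)$ is an optimal transport plan (for the quadratic cost) between $\mu_h$ and $\nu_h$, then $$\Big(\int_{X\times Y}|T(x')-y'|^2\,d\gamma_h(x',y')\Big)^{1/2}\le 2\lambda^{1/2}\,e_h^{1/2}\big(W_2(\mu,\nu)+e_h\big)^{1/2}+\lambda e_{\alpha_h}+e_{\beta_h}.$$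
   Context: $P_2(\mathbb{R}^d)$ is the set of Borel probability measures on $\mathbb{R}^d$ with finite second moment. $\Pi(\mu,\nu)$ is the set of transport plans, i.e. Borel probability measures on the product space with first marginal $\mu$ and second marginal $\nu$. $W_2(\mu,\nu)=\big(\min_{\gamma\in\Pi(\mu,\nu)}\int|x-y|^2\,d\gamma(x,y)\big)^{1/2}$ is the quadratic Wasserstein distance; a plan attaining the minimum is called optimal. A map $T$ is an optimal transport map from $\mu$ to $\nu$ if $T_\#\mu=\nu$ and $T$ minimizes $\int|x-S(x)|^2\,d\mu(x)$ among all measurable maps $S$ with $S_\#\mu=\nu$. $\lambda$-regularity: $(\mu,\nu,\varphi)$ is $\lambda$-regular ($\lambda>0$) if $\varphi:\mathbb{R}^d\to\mathbb{R}$ is convex, $\nabla\varphi$ is the optimal transport map from $\mu$ to $\nu$ (for the quadratic cost), and $\varphi$ is $\lambda$-smooth, meaning $$\varphi((1-t)x_0+tx_1)+\frac{t(1-t)\lambda}{2}|x_0-x_1|^2\ge(1-t)\varphi(x_0)+t\varphi(x_1)$$ for all $x_0,x_1\in\mathbb{R}^d$, $t\in[0,1]$; equivalently, $\frac{\lambda}{2}|x|^2-\varphi(x)$ is convex. (Such a $\varphi$ is differentiable everywhere, so $T=\nabla\varphi$ is defined on all of $\mathbb{R}^d$.) *)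

theory Defs
  imports "HOL-Probability.Probability"
begin

definition P2 :: "'a::euclidean_space measure set" where
  "P2 = {\<mu>. prob_space \<mu> \<and> sets \<mu> = sets borel \<and> integrable \<mu> (\<lambda>x. (norm x)\<^sup>2)}"

definition transport_plans ::
    "'a::euclidean_space measure \<Rightarrow> 'a measure \<Rightarrow> ('a \<times> 'a) measure set" where
  "transport_plans \<mu> \<nu> = {\<gamma>. prob_space \<gamma> \<and> sets \<gamma> = sets borel
      \<and> distr \<gamma> borel fst = \<mu> \<and> distr \<gamma> borel snd = \<nu>}"

(* Costs that are minimised take values in ennreal, so that an infinite cost is not
   read as 0, as it would be with the Bochner integral. *)
definition plan_cost :: "('a::euclidean_space \<times> 'a) measure \<Rightarrow> ennreal" where
  "plan_cost \<gamma> = (\<integral>\<^sup>+ (x, y). ennreal ((norm (x - y))\<^sup>2) \<partial>\<gamma>)"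

definition optimal_plan ::
    "'a::euclidean_space measure \<Rightarrow> 'a measure \<Rightarrow> ('a \<times> 'a) measure \<Rightarrow> bool" where
  "optimal_plan \<mu> \<nu> \<gamma> \<longleftrightarrow> \<gamma> \<in> transport_plans \<mu> \<nu> \<and>
     (\<forall>\<gamma>' \<in> transport_plans \<mu> \<nu>. plan_cost \<gamma> \<le> plan_cost \<gamma>')"

(* The infimum is a minimum, and it is finite for measures in P2. *)
definition W2 :: "'a::euclidean_space measure \<Rightarrow> 'a measure \<Rightarrow> real" where
  "W2 \<mu> \<nu> = sqrt (enn2real (INF \<gamma> \<in> transport_plans \<mu> \<nu>. plan_cost \<gamma>))"

definition map_cost :: "'a::euclidean_space measure \<Rightarrow> ('a \<Rightarrow> 'a) \<Rightarrow> ennreal" where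
  "map_cost \<mu> S = (\<integral>\<^sup>+ x. ennreal ((norm (x - S x))\<^sup>2) \<partial>\<mu>)"

definition optimal_map ::
    "'a::euclidean_space measure \<Rightarrow> 'a measure \<Rightarrow> ('a \<Rightarrow> 'a) \<Rightarrow> bool" where
  "optimal_map \<mu> \<nu> T \<longleftrightarrow> T \<in> borel_measurable \<mu> \<and> distr \<mu> borel T = \<nu> \<and>
     (\<forall>S \<in> borel_measurable \<mu>. distr \<mu> borel S = \<nu> \<longrightarrow> map_cost \<mu> T \<le> map_cost \<mu> S)"

(* Meaningful at points of differentiability, where the gradient is unique. *)
definition gradient :: "('a::euclidean_space \<Rightarrow> real) \<Rightarrow> 'a \<Rightarrow> 'a" where
  "gradient \<phi> x = (THE D. GDERIV \<phi> x :> D)"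

definition smooth_with :: "real \<Rightarrow> ('a::euclidean_space \<Rightarrow> real) \<Rightarrow> bool" where
  "smooth_with lam \<phi> \<longleftrightarrow> (\<forall>x\<^sub>0 x\<^sub>1. \<forall>t \<in> {0..1}.
     \<phi> ((1 - t) *\<^sub>R x\<^sub>0 + t *\<^sub>R x\<^sub>1) + t * (1 - t) * lam / 2 * (norm (x\<^sub>0 - x\<^sub>1))\<^sup>2
       \<ge> (1 - t) * \<phi> x\<^sub>0 + t * \<phi> x\<^sub>1)"

(* Convexity and smoothness imply that the potential is differentiable everywhere,
   so its gradient is a genuine one at every point. *)
definition regular ::
    "real \<Rightarrow> 'a::euclidean_space measure \<Rightarrow> 'a measure \<Rightarrow> ('a \<Rightarrow> real) \<Rightarrow> bool" where
  "regular lam \<mu> \<nu> \<phi> \<longleftrightarrow> lam > 0 \<and> convex_on UNIV \<phi> \<and> optimal_map \<mu> \<nu> (gradient \<phi>) \<and> smooth_with lam \<phi>"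

end

theory Submission
  imports Defs
begin

text \<open>
  Smoothness makes the conjugate $\varphi^*$ strongly convex, so the Fenchel gap
  $\varphi(x) + \varphi^*(y) - x \cdot y$ dominates $|T x - y|^2 / (2\lambda)$. Integrated against a plan
  $\gamma \in \Pi(\mu, \nu)$, this gives
  $\int |T x - y|^2 d\gamma \le \lambda (\int |x - y|^2 d\gamma - W_2^2(\mu, \nu))$.
  Apply it to the law of the outer variables of $\alpha_h$, $\gamma_h$, $\beta_h$ glued together; its cost is at
  most $(W_2(\mu, \nu) + 2 e_h)^2$ by optimality of $\gamma_h$. Minkowski's inequality and the
  $\lambda$-Lipschitz continuity of $T$ move the estimate back to $\gamma_h$. The gluing is only
  approximate, with an error that tends to zero.
\<close>

section \<open>Gradients of smooth convex functions\<close>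

text \<open>Write W for the distance between \<mu> and \<nu>. The main term comes from (W + 2 s)^2 -
  W^2 = 4 s (W + s) with s = e_h, whence the factor 2 under the root. The amount e_h enters twice:
  once when the cost of \<open>\<gamma>h\<close> is compared with that of a nearly optimal plan
  between \<mu> and \<nu>, and once when \<open>\<gamma>h\<close> is carried back to \<mu> and
  \<nu>. In the Fenchel gap only the inner product of x and y depends on the coupling. Since T
  pushes \<mu> to \<nu>, the conjugate has the same integral in y as in T x, and what survives is
  the cost of the plan minus the cost of the plan on the graph of T, which is at least W^2. This
  cancellation needs a measurable, integrable conjugate, whereas the conjugate may be infinite off
  the range of T. So it is replaced by a real function on a Borel set that contains this
  range.\<close>

lemma convex_subgradient_exists:
  fixes \<phi> :: "'a::euclidean_space \<Rightarrow> real"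
  assumes "convex_on UNIV \<phi>"
  shows "\<exists>p. \<forall>y. \<phi> x + p \<bullet> (y - x) \<le> \<phi> y"
proof -
  \<comment> \<open>The strict epigraph is convex and omits the point \<open>(x, \<phi> x)\<close>,
    so a hyperplane separates the two; its normal, scaled to last component 1, gives the slope. The
    missing boundary is recovered at the end by letting the height decrease to
    \<open>\<phi> y\<close>.\<close>
  let ?E = "{z. \<phi> (fst z) < snd z} :: ('a \<times> real) set"
  have "convex ?E"
  proof (rule convexI, clarsimp)
    fix a b :: 'a and r s u v :: real
    assume h: "\<phi> a < r" "\<phi> b < s" "0 \<le> u" "0 \<le> v" "u + v = 1"
    have "\<phi> (u *\<^sub>R a + v *\<^sub>R b) \<le> u * \<phi> a + v * \<phi> b"
      using assms h by (simp add: convex_on_def)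
    also have "\<dots> < u * r + v * s"
    proof (cases "u = 0")
      case False
      with h have "u * \<phi> a < u * r" "v * \<phi> b \<le> v * s" by (auto intro: mult_left_mono)
      then show ?thesis by simp
    qed (use h in auto)
    finally show "\<phi> (u *\<^sub>R a + v *\<^sub>R b) < u * r + v * s" .
  qed
  moreover have "(x, \<phi> x + 1) \<in> ?E" by simp
  ultimately have "\<exists>a b. a \<noteq> 0 \<and> (\<forall>z\<in>{(x, \<phi> x)}. a \<bullet> z \<le> b) \<and> (\<forall>z\<in>?E. a \<bullet> z \<ge> b)"
    by (intro separating_hyperplane_sets) (simp, assumption, simp, blast, simp)
  then obtain a b where ab: "a \<noteq> 0" "a \<bullet> (x, \<phi> x) \<le> b" "\<And>z. z \<in> ?E \<Longrightarrow> b \<le> a \<bullet> z"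
    by blast
  obtain p s where a: "a = (p, s)" by (cases a)
  have le: "p \<bullet> x + s * \<phi> x \<le> p \<bullet> y + s * r" if "\<phi> y < r" for y r
    using ab(2) ab(3)[of "(y, r)"] that by (simp add: a)
  have "s \<ge> 0"
    using le[of x "\<phi> x + 1"] by (simp add: algebra_simps)
  \<comment> \<open>The hyperplane is not vertical because \<open>\<phi>\<close> is finite
    everywhere: with \<open>s = 0\<close>, the epigraph over \<open>x - p\<close> would force the
    normal to vanish.\<close>
  moreover have "s \<noteq> 0"
  proof
    assume "s = 0"
    then have "p \<bullet> p \<le> 0" using le[of "x - p" "\<phi> (x - p) + 1"] by (simp add: inner_diff_right)
    then have "p = 0" by (metis inner_gt_zero_iff not_le)
    then show False using ab(1) \<open>s = 0\<close> by (simp add: a zero_prod_def)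
  qed
  ultimately have s: "s > 0" by simp
  have "\<phi> x + (- p /\<^sub>R s) \<bullet> (y - x) \<le> \<phi> y" for y
  proof (rule dense_ge)
    fix r assume "\<phi> y < r"
    have "s * (\<phi> x + (- p /\<^sub>R s) \<bullet> (y - x)) = s * \<phi> x - p \<bullet> (y - x)"
      using s by (simp add: right_diff_distrib)
    also have "\<dots> \<le> s * r"
      using le[OF \<open>\<phi> y < r\<close>] by (simp add: inner_diff_right)
    finally have "s * (\<phi> x + (- p /\<^sub>R s) \<bullet> (y - x)) \<le> s * r" .
    then show "\<phi> x + (- p /\<^sub>R s) \<bullet> (y - x) \<le> r" using s by simp
  qed
  then show ?thesis by blast
qed

text \<open>\<open>x\<close> is the midpoint of \<open>y\<close> and its reflection
  \<open>2 *\<^sub>R x - y\<close>. The smoothness inequality at the midpoint bounds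
  \<open>\<phi> y\<close> from above, once the subgradient bounds the reflected value from below.
  The constant \<open>lam\<close> is twice the sharp one; it suffices for differentiability, and
  \<open>gradient_upper\<close> sharpens it.\<close>

lemma smooth_with_subgradient_upper:
  fixes \<phi> :: "'a::euclidean_space \<Rightarrow> real"
  assumes smooth: "smooth_with lam \<phi>" and sub: "\<And>y. \<phi> x + p \<bullet> (y - x) \<le> \<phi> y"
  shows "\<phi> y \<le> \<phi> x + p \<bullet> (y - x) + lam * (norm (y - x))\<^sup>2"
proof -
  have "y - (2 *\<^sub>R x - y) = 2 *\<^sub>R (y - x)"
    by (simp add: algebra_simps scaleR_2)
  moreover have "(1 / 2) *\<^sub>R y + (1 / 2) *\<^sub>R (2 *\<^sub>R x - y) = x"
    by (simp add: algebra_simps)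
  ultimately have "\<phi> x + lam / 8 * (norm (2 *\<^sub>R (y - x)))\<^sup>2 \<ge> \<phi> y / 2 + \<phi> (2 *\<^sub>R x - y) / 2"
    using smooth[unfolded smooth_with_def, rule_format, of "1/2" y "2 *\<^sub>R x - y"]
    by (simp add: field_simps)
  moreover have "\<phi> x - p \<bullet> (y - x) \<le> \<phi> (2 *\<^sub>R x - y)"
    using sub[of "2 *\<^sub>R x - y"] by (simp add: inner_diff_right scaleR_2)
  ultimately show ?thesis by (simp add: power_mult_distrib)
qed

text \<open>The affine remainder is squeezed between 0 and a quadratic, so a subgradient is the
  derivative. Uniqueness of derivatives then makes the \<open>THE\<close> in \<open>gradient\<close>
  well defined at every point.\<close>

lemma smooth_with_has_gderiv:
  fixes \<phi> :: "'a::euclidean_space \<Rightarrow> real"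
  assumes "smooth_with lam \<phi>" and sub: "\<And>y. \<phi> x + p \<bullet> (y - x) \<le> \<phi> y"
  shows "GDERIV \<phi> x :> p"
proof -
  have up: "\<bar>\<phi> y - \<phi> x - p \<bullet> (y - x)\<bar> \<le> lam * (norm (y - x))\<^sup>2" for y
    using smooth_with_subgradient_upper[OF assms, of y] sub[of y] by auto
  have "((\<lambda>y. (\<phi> y - \<phi> x - p \<bullet> (y - x)) / norm (y - x)) \<longlongrightarrow> 0) (at x)"
  proof (rule Lim_null_comparison)
    show "\<forall>\<^sub>F y in at x. norm ((\<phi> y - \<phi> x - p \<bullet> (y - x)) / norm (y - x)) \<le> lam * norm (y - x)"
      using up by (intro always_eventually allI) (auto simp: divide_simps power2_eq_square mult.assoc)
    show "((\<lambda>y. lam * norm (y - x)) \<longlongrightarrow> 0) (at x)"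
      by (auto intro!: tendsto_eq_intros)
  qed
  then show ?thesis
    unfolding gderiv_def has_derivative_at2
    by (auto simp: inner_commute[of _ p] bounded_linear_inner_right
          field_simps intro!: bounded_linear_inner_right)
qed

context
  fixes lam :: real and \<phi> :: "'a::euclidean_space \<Rightarrow> real"
  assumes lam: "lam > 0" and convex: "convex_on UNIV \<phi>" and smooth: "smooth_with lam \<phi>"
begin

lemma gradient_lower: "\<phi> x + gradient \<phi> x \<bullet> (y - x) \<le> \<phi> y"
proof -
  obtain p where p: "\<And>y. \<phi> x + p \<bullet> (y - x) \<le> \<phi> y"
    using convex_subgradient_exists[OF convex] by blast
  then have "GDERIV \<phi> x :> p" by (rule smooth_with_has_gderiv[OF smooth])
  moreover have "D = p" if "GDERIV \<phi> x :> D" for D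
    using has_derivative_unique[OF that[unfolded gderiv_def] \<open>GDERIV \<phi> x :> p\<close>[unfolded gderiv_def]]
    by (metis vector_eq_ldot)
  ultimately have "gradient \<phi> x = p"
    unfolding gradient_def by (rule the_equality)
  with p show ?thesis by simp
qed

text \<open>The crude bound is applied only to the short step \<open>t *\<^sub>R (y - x)\<close>,
  where it costs order t^2; smoothness along the segment extends it to \<open>y\<close>. After
  division by \<open>t\<close> the excess is of order \<open>t\<close> and vanishes in the limit,
  which leaves the sharp constant \<open>lam / 2\<close>.\<close>

lemma gradient_upper: "\<phi> y \<le> \<phi> x + gradient \<phi> x \<bullet> (y - x) + lam / 2 * (norm (y - x))\<^sup>2"
proof -
  let ?d = "y - x" and ?g = "gradient \<phi> x"
  have le: "\<phi> y \<le> \<phi> x + ?g \<bullet> ?d + lam / 2 * (norm ?d)\<^sup>2 + t * (lam / 2 * (norm ?d)\<^sup>2)"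
    if t: "0 < t" "t \<le> 1" for t
  proof -
    have "\<phi> (x + t *\<^sub>R ?d) \<le> \<phi> x + t * (?g \<bullet> ?d) + lam * (t\<^sup>2 * (norm ?d)\<^sup>2)"
      using smooth_with_subgradient_upper[OF smooth gradient_lower, of "x + t *\<^sub>R ?d" x] by (simp add: power_mult_distrib)
    moreover have "(1 - t) *\<^sub>R x + t *\<^sub>R y = x + t *\<^sub>R ?d"
      by (simp add: algebra_simps)
    then have "(1 - t) * \<phi> x + t * \<phi> y \<le> \<phi> (x + t *\<^sub>R ?d) + t * (1 - t) * lam / 2 * (norm ?d)\<^sup>2"
      using smooth[unfolded smooth_with_def, rule_format, of t x y] t
      by (simp add: norm_minus_commute)
    ultimately have "t * \<phi> y \<le> t * (\<phi> x + ?g \<bullet> ?d + lam / 2 * (norm ?d)\<^sup>2 + t * (lam / 2 * (norm ?d)\<^sup>2))"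
      by (simp add: power2_eq_square field_simps)
    with t show ?thesis by simp
  qed
  have "((\<lambda>t. \<phi> x + ?g \<bullet> ?d + lam / 2 * (norm ?d)\<^sup>2 + t * (lam / 2 * (norm ?d)\<^sup>2))
      \<longlongrightarrow> \<phi> x + ?g \<bullet> ?d + lam / 2 * (norm ?d)\<^sup>2) (at_right 0)"
    by (auto intro!: tendsto_eq_intros)
  moreover have "\<forall>\<^sub>F t in at_right (0::real). \<phi> y \<le> \<phi> x + ?g \<bullet> ?d + lam / 2 * (norm ?d)\<^sup>2 + t * (lam / 2 * (norm ?d)\<^sup>2)"
    unfolding eventually_at_right_field using le by (intro exI[of _ 1]) auto
  ultimately show ?thesis by (rule tendsto_lowerbound) simp
qed

text \<open>The tangent plane at \<open>x\<close> lies below \<open>\<phi>\<close> and the quadratic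
  at \<open>y\<close> lies above it. Comparing the two at a well-chosen third point gains the square
  of the gradient difference.\<close>

lemma gradient_cocoercive:
  "\<phi> x + gradient \<phi> x \<bullet> (y - x) + (norm (gradient \<phi> y - gradient \<phi> x))\<^sup>2 / (2 * lam) \<le> \<phi> y"
proof -
  define g where "g = gradient \<phi> y - gradient \<phi> x"
  \<comment> \<open>This point minimises the quadratic upper bound at \<open>y\<close> minus the
    tangent plane at \<open>x\<close>.\<close>
  define z where "z = y - g /\<^sub>R lam"
  have "\<phi> x + gradient \<phi> x \<bullet> (z - x) \<le> \<phi> y + gradient \<phi> y \<bullet> (z - y) + lam / 2 * (norm (z - y))\<^sup>2"
    using gradient_lower[of x z] gradient_upper[of z y] by linarith
  moreover have "gradient \<phi> x \<bullet> (z - x) = gradient \<phi> x \<bullet> (y - x) - gradient \<phi> x \<bullet> g / lam"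
    by (simp add: z_def inner_diff_right divide_inverse)
  moreover have "gradient \<phi> y \<bullet> (z - y) = - (gradient \<phi> x \<bullet> g / lam) - (norm g)\<^sup>2 / lam"
    by (simp add: z_def g_def inner_diff_left inner_diff_right inner_commute power2_norm_eq_inner divide_inverse algebra_simps)
  moreover have "lam / 2 * (norm (z - y))\<^sup>2 = (norm g)\<^sup>2 / (2 * lam)"
    using lam by (simp add: z_def power_mult_distrib power2_eq_square field_simps)
  ultimately show ?thesis by (simp add: g_def field_simps)
qed

text \<open>Cocoercivity is added to itself with \<open>x\<close> and \<open>y\<close> exchanged,
  then Cauchy-Schwarz is applied. The sharp constant matters: it is the factor of e_\<alpha> in the
  final bound.\<close>

lemma gradient_lipschitz: "norm (gradient \<phi> y - gradient \<phi> x) \<le> lam * norm (y - x)"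
proof -
  let ?g = "gradient \<phi> y - gradient \<phi> x"
  have "(norm ?g)\<^sup>2 / lam \<le> ?g \<bullet> (y - x)"
    using gradient_cocoercive[of x y] gradient_cocoercive[of y x]
    by (simp add: norm_minus_commute inner_diff_left inner_diff_right)
  also have "\<dots> \<le> norm ?g * norm (y - x)" by (rule norm_cauchy_schwarz)
  finally have "norm ?g * norm ?g \<le> norm ?g * (lam * norm (y - x))"
    using lam by (simp add: power2_eq_square field_simps)
  then show ?thesis using lam by (cases "norm ?g = 0") auto
qed

lemma gradient_continuous: "continuous_on UNIV (gradient \<phi>)"
  using gradient_lipschitz lam
  by (intro lipschitz_on_continuous_on[of lam]) (simp add: lipschitz_on_def dist_norm)

lemma potential_continuous: "continuous_on UNIV \<phi>"
  using convex_on_continuous[OF open_UNIV convex] .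

section \<open>The Fenchel gap and the convex conjugate\<close>

text \<open>Here \<open>v\<close> stands for the conjugate at \<open>y\<close>, and
  \<open>x \<bullet> gradient \<phi> x - \<phi> x\<close> is the conjugate at the gradient of
  \<open>x\<close>. The bracket is twice the Fenchel gap
  \<open>v - x \<bullet> y + \<phi> x\<close>, expanded so that under a plan the terms in
  \<open>y\<close> cancel those in the gradient and two transport costs remain.\<close>

lemma gradient_gap_le:
  assumes v: "\<And>z. z \<bullet> y - \<phi> z \<le> v"
  shows "(norm (gradient \<phi> x - y))\<^sup>2 \<le> lam * ((norm (x - y))\<^sup>2 - (norm (x - gradient \<phi> x))\<^sup>2
    - (norm y)\<^sup>2 + (norm (gradient \<phi> x))\<^sup>2 + 2 * v - 2 * (x \<bullet> gradient \<phi> x - \<phi> x))"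
proof -
  let ?T = "gradient \<phi> x"
  define d where "d = y - ?T"
  \<comment> \<open>The maximiser of \<open>z \<bullet> y\<close> minus the quadratic upper bound of
    \<open>\<phi>\<close> at \<open>x\<close>; it gives the best lower bound on
    \<open>v\<close>.\<close>
  define z where "z = x + d /\<^sub>R lam"
  have norm_d: "norm d = norm (?T - y)" by (simp add: d_def norm_minus_commute)
  have zx: "z - x = d /\<^sub>R lam" by (simp add: z_def)
  have "z \<bullet> y - (\<phi> x + ?T \<bullet> (z - x) + lam / 2 * (norm (z - x))\<^sup>2) \<le> v"
    using gradient_upper[of z x] v[of z] by linarith
  moreover have "lam / 2 * (norm (z - x))\<^sup>2 = (norm d)\<^sup>2 / (2 * lam)"
    using lam unfolding zx norm_scaleR by (simp add: power2_eq_square field_simps)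
  moreover have "z \<bullet> y - ?T \<bullet> (z - x) = x \<bullet> y + (norm d)\<^sup>2 / lam"
  proof -
    have "z \<bullet> y - ?T \<bullet> (z - x) = x \<bullet> y + (d \<bullet> y - d \<bullet> ?T) / lam"
      unfolding zx by (simp add: z_def inner_add_left inner_commute[of ?T] divide_inverse left_diff_distrib)
    also have "d \<bullet> y - d \<bullet> ?T = (norm d)\<^sup>2"
      by (simp add: d_def power2_norm_eq_inner inner_diff_right)
    finally show ?thesis .
  qed
  moreover have "(norm d)\<^sup>2 / lam = 2 * ((norm d)\<^sup>2 / (2 * lam))" by simp
  ultimately have "(norm d)\<^sup>2 / (2 * lam) \<le> v - x \<bullet> y + \<phi> x" by linarith
  then have "(norm d)\<^sup>2 \<le> lam * (2 * (v - x \<bullet> y + \<phi> x))"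
    using lam by (simp add: pos_divide_le_eq mult_ac)
  also have "2 * (v - x \<bullet> y + \<phi> x) = (norm (x - y))\<^sup>2 - (norm (x - ?T))\<^sup>2
      - (norm y)\<^sup>2 + (norm ?T)\<^sup>2 + 2 * v - 2 * (x \<bullet> ?T - \<phi> x)"
    by (simp add: power2_norm_eq_inner inner_diff_left inner_diff_right inner_commute)
  finally show ?thesis unfolding norm_d .
qed

text \<open>A supremum over a countable dense set is measurable, and continuity of
  \<open>\<phi>\<close> makes it the full conjugate. It is taken in \<open>ereal\<close> because it
  may be infinite; \<open>S\<close> collects the points where it is finite, and there its real value
  can be used.\<close>

lemma conjugate_on_gradient_range:
  obtains \<psi> :: "'a \<Rightarrow> real" and S :: "'a set"
  where "\<psi> \<in> borel_measurable borel" "S \<in> sets borel" "\<And>x. gradient \<phi> x \<in> S"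
    "\<And>x. \<psi> (gradient \<phi> x) = x \<bullet> gradient \<phi> x - \<phi> x"
    "\<And>y z. y \<in> S \<Longrightarrow> z \<bullet> y - \<phi> z \<le> \<psi> y"
proof -
  obtain D :: "'a set" where D: "countable D" "\<And>X. open X \<Longrightarrow> X \<noteq> {} \<Longrightarrow> \<exists>d\<in>D. d \<in> X"
    using countable_dense_setE by blast
  define \<Phi> where "\<Phi> y = (SUP d\<in>D. ereal (d \<bullet> y - \<phi> d))" for y
  have [measurable]: "\<Phi> \<in> borel_measurable borel"
    unfolding \<Phi>_def using D(1) by (intro borel_measurable_SUP) auto
  have lower: "ereal (z \<bullet> y - \<phi> z) \<le> \<Phi> y" for z y
  proof (rule ccontr)
    assume "\<not> ?thesis"
    \<comment> \<open>A violation at one \<open>z\<close> persists on a neighbourhood, hence at some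
      point of the dense set, against the definition of the supremum.\<close>
    moreover have "open {z. \<Phi> y < ereal (z \<bullet> y - \<phi> z)}"
      using potential_continuous by (intro open_Collect_less continuous_intros)
    ultimately obtain d where "d \<in> D" "\<Phi> y < ereal (d \<bullet> y - \<phi> d)"
      using D(2)[of "{z. \<Phi> y < ereal (z \<bullet> y - \<phi> z)}"] by (auto simp: not_le)
    then show False
      unfolding \<Phi>_def by (metis (no_types, lifting) SUP_upper not_le)
  qed
  have upper: "\<Phi> (gradient \<phi> x) = ereal (x \<bullet> gradient \<phi> x - \<phi> x)" for x
  proof (rule antisym[OF _ lower])
    show "\<Phi> (gradient \<phi> x) \<le> ereal (x \<bullet> gradient \<phi> x - \<phi> x)"
      unfolding \<Phi>_def
    proof (rule SUP_least)
      fix d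
      show "ereal (d \<bullet> gradient \<phi> x - \<phi> d) \<le> ereal (x \<bullet> gradient \<phi> x - \<phi> x)"
        using gradient_lower[of x d] by (simp add: inner_diff_right inner_commute)
    qed
  qed
  show ?thesis
  proof (rule that[of "\<lambda>y. real_of_ereal (\<Phi> y)" "{y. \<Phi> y \<noteq> \<infinity>}"])
    fix y z assume "y \<in> {y. \<Phi> y \<noteq> \<infinity>}"
    then show "z \<bullet> y - \<phi> z \<le> real_of_ereal (\<Phi> y)"
      using lower[of z y] by (cases "\<Phi> y") auto
  qed (simp_all add: upper)
qed

end

section \<open>Gluing of measures\<close>

text \<open>Integrating over \<open>y\<close> yields the mass of the fibre \<open>q = p x\<close>,
  which equals that of the fibre of \<open>p\<close> and cancels the inverse weight. The statement
  is kept general so that, with the roles exchanged, it gives both marginals of the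
  coupling.\<close>

lemma nn_integral_fibre_weight:
  fixes p :: "'m \<Rightarrow> nat" and q :: "'n \<Rightarrow> nat"
  assumes "prob_space M" "prob_space N"
    and [measurable]: "p \<in> measurable M (count_space UNIV)" "q \<in> measurable N (count_space UNIV)"
    and eq: "\<And>n. emeasure M (p -` {n} \<inter> space M) = emeasure N (q -` {n} \<inter> space N)"
    and A[measurable]: "A \<in> sets M"
  shows "(\<integral>\<^sup>+ x. \<integral>\<^sup>+ y. (if p x = q y then inverse (emeasure M (p -` {p x} \<inter> space M)) else 0) * indicator A x \<partial>N \<partial>M)
    = emeasure M A"
proof -
  interpret M: prob_space M by fact
  interpret N: prob_space N by fact
  let ?w = "\<lambda>n. emeasure M (p -` {n} \<inter> space M)"
  \<comment> \<open>On a fibre of mass 0 the weight is \<open>top\<close> and the product with the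
    mass is 0 instead of 1. There are only countably many fibres, so these points form a null
    set.\<close>
  have "AE x in M. \<forall>n. ?w n = 0 \<longrightarrow> p x \<noteq> n"
  proof (subst AE_all_countable, intro allI)
    fix n
    show "AE x in M. ?w n = 0 \<longrightarrow> p x \<noteq> n"
    proof (cases "?w n = 0")
      case True
      then show ?thesis by (intro AE_I[of _ _ "p -` {n} \<inter> space M"]) auto
    qed simp
  qed
  then have pos: "AE x in M. ?w (p x) \<noteq> 0" by eventually_elim auto
  have "(\<integral>\<^sup>+ y. (if p x = q y then inverse (?w (p x)) else 0) * indicator A x \<partial>N)
      = inverse (?w (p x)) * indicator A x * ?w (p x)" for x
  proof -
    have "(\<integral>\<^sup>+ y. (if p x = q y then inverse (?w (p x)) else 0) * indicator A x \<partial>N)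
        = (\<integral>\<^sup>+ y. inverse (?w (p x)) * indicator A x * indicator (q -` {p x} \<inter> space N) y \<partial>N)"
      by (intro nn_integral_cong) (auto simp: indicator_def)
    then show ?thesis by (simp add: nn_integral_cmult_indicator eq)
  qed
  then have "(\<integral>\<^sup>+ x. \<integral>\<^sup>+ y. (if p x = q y then inverse (?w (p x)) else 0) * indicator A x \<partial>N \<partial>M)
      = (\<integral>\<^sup>+ x. inverse (?w (p x)) * indicator A x * ?w (p x) \<partial>M)"
    by simp
  also have "\<dots> = (\<integral>\<^sup>+ x. indicator A x \<partial>M)"
  proof (intro nn_integral_cong_AE)
    show "AE x in M. inverse (?w (p x)) * indicator A x * ?w (p x) = indicator A x"
      using pos
    proof eventually_elim
      case (elim x)
      have "inverse (?w (p x)) * ?w (p x) = 1"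
        using elim by (simp add: M.emeasure_eq_measure divide_ennreal_def[symmetric] mult.commute ennreal_divide_self)
      then show ?case by (auto simp: indicator_def)
    qed
  qed
  finally show ?thesis by simp
qed

text \<open>The plan $\sum_n M|_{p = n} \otimes N|_{q = n} / M(p = n)$, written as a density on the product measure.
  It replaces disintegration: gluing along a countable partition into small cells matches the
  common marginal only up to \<open>e\<close>, which suffices for a limit argument.\<close>

lemma coupling_along_discrete:
  fixes p :: "'m \<Rightarrow> nat" and q :: "'n \<Rightarrow> nat"
  assumes M: "prob_space M" and N: "prob_space N"
    and [measurable]: "p \<in> measurable M (count_space UNIV)" "q \<in> measurable N (count_space UNIV)"
    and eq: "\<And>n. emeasure M (p -` {n} \<inter> space M) = emeasure N (q -` {n} \<inter> space N)"
  obtains K where "prob_space K" "sets K = sets (M \<Otimes>\<^sub>M N)" "distr K M fst = M" "distr K N snd = N"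
    "AE z in K. p (fst z) = q (snd z)"
proof -
  interpret M: prob_space M by fact
  interpret N: prob_space N by fact
  interpret MN: pair_sigma_finite M N ..
  define w where "w n = inverse (emeasure M (p -` {n} \<inter> space M))" for n
  define h where "h z = (if p (fst z) = q (snd z) then w (p (fst z)) else 0)" for z
  have "Measurable.pred (M \<Otimes>\<^sub>M N) (\<lambda>z. \<exists>n. p (fst z) = n \<and> q (snd z) = n)"
    by measurable
  then have [measurable]: "Measurable.pred (M \<Otimes>\<^sub>M N) (\<lambda>z. p (fst z) = q (snd z))"
    by (simp add: eq_commute)
  have [measurable]: "(\<lambda>z. w (p (fst z))) \<in> borel_measurable (M \<Otimes>\<^sub>M N)"
    by (rule measurable_compose[where N = "count_space UNIV"]) simp_all
  have [measurable]: "h \<in> borel_measurable (M \<Otimes>\<^sub>M N)"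
    unfolding h_def by measurable
  define K where "K = density (M \<Otimes>\<^sub>M N) h"
  have sets_K[measurable_cong, simp]: "sets K = sets (M \<Otimes>\<^sub>M N)" by (simp add: K_def)
  have space_K: "space K = space M \<times> space N" using sets_eq_imp_space_eq[OF sets_K] by (simp add: space_pair_measure)
  have 1: "distr K M fst = M"
  proof (rule measure_eqI)
    fix A assume "A \<in> sets (distr K M fst)"
    then have A[measurable]: "A \<in> sets M" by simp
    have "fst -` A \<inter> space K = A \<times> space N"
      using sets.sets_into_space[OF A] by (auto simp: space_K)
    then have "emeasure (distr K M fst) A = (\<integral>\<^sup>+ z. h z * indicator (A \<times> space N) z \<partial>(M \<Otimes>\<^sub>M N))"
      by (simp add: emeasure_distr) (simp add: K_def emeasure_density)
    also have "\<dots> = (\<integral>\<^sup>+ x. \<integral>\<^sup>+ y. h (x, y) * indicator (A \<times> space N) (x, y) \<partial>N \<partial>M)"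
      by (rule N.nn_integral_fst[symmetric]) measurable
    also have "\<dots> = (\<integral>\<^sup>+ x. \<integral>\<^sup>+ y. (if p x = q y then inverse (emeasure M (p -` {p x} \<inter> space M)) else 0) * indicator A x \<partial>N \<partial>M)"
      by (intro nn_integral_cong) (auto simp: h_def w_def indicator_def)
    finally show "emeasure (distr K M fst) A = emeasure M A"
      by (simp add: nn_integral_fibre_weight[OF M N _ _ eq])
  qed simp
  have 2: "distr K N snd = N"
  proof (rule measure_eqI)
    fix A assume "A \<in> sets (distr K N snd)"
    then have A[measurable]: "A \<in> sets N" by simp
    have "snd -` A \<inter> space K = space M \<times> A"
      using sets.sets_into_space[OF A] by (auto simp: space_K)
    then have "emeasure (distr K N snd) A = (\<integral>\<^sup>+ z. h z * indicator (space M \<times> A) z \<partial>(M \<Otimes>\<^sub>M N))"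
      by (simp add: emeasure_distr) (simp add: K_def emeasure_density)
    also have "\<dots> = (\<integral>\<^sup>+ y. \<integral>\<^sup>+ x. h (x, y) * indicator (space M \<times> A) (x, y) \<partial>M \<partial>N)"
      by (rule MN.nn_integral_snd[symmetric]) measurable
    also have "\<dots> = (\<integral>\<^sup>+ y. \<integral>\<^sup>+ x. (if q y = p x then inverse (emeasure N (q -` {q y} \<inter> space N)) else 0) * indicator A y \<partial>M \<partial>N)"
      by (intro nn_integral_cong) (auto simp: h_def w_def indicator_def eq)
    finally show "emeasure (distr K N snd) A = emeasure N A"
      by (simp add: nn_integral_fibre_weight[OF N M _ _ eq[symmetric]])
  qed simp
  have "prob_space K"
    by (rule prob_space_distrD[of fst K M]) (simp_all add: 1 M)
  moreover have "AE z in K. p (fst z) = q (snd z)"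
    unfolding K_def by (subst AE_density) (auto simp: h_def)
  ultimately show ?thesis using that 1 2 by simp
qed

text \<open>Each point is labelled by the first member of a dense sequence at distance less than
  \<open>e / 2\<close>; two points with the same label share that member.\<close>

lemma countable_partition_small:
  fixes e :: real
  assumes "e > 0"
  obtains c :: "'b::{metric_space, second_countable_topology} \<Rightarrow> nat"
  where "c \<in> measurable borel (count_space UNIV)" "\<And>x y. c x = c y \<Longrightarrow> dist x y < e"
proof -
  obtain D :: "'b set" where D: "countable D" "\<And>X. open X \<Longrightarrow> X \<noteq> {} \<Longrightarrow> \<exists>d\<in>D. d \<in> X"
    using countable_dense_setE by blast
  define d where "d = from_nat_into D"
  define c where "c x = (LEAST n. dist (d n) x < e / 2)" for x
  have near: "dist (d (c x)) x < e / 2" for x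
  proof -
    obtain y where "y \<in> D" "dist x y < e / 2"
      using D(2)[of "ball x (e / 2)"] assms by auto
    then have "dist (d (to_nat_on D y)) x < e / 2"
      using D(1) by (simp add: d_def dist_commute)
    then show ?thesis unfolding c_def by (rule LeastI)
  qed
  show ?thesis
  proof
    show "c \<in> measurable borel (count_space UNIV)" unfolding c_def by measurable
    show "dist x y < e" if "c x = c y" for x y
      using near[of x] near[of y] that dist_triangle_half_r by metis
  qed
qed

text \<open>Since \<open>f\<close> and \<open>g\<close> have the same law, every small cell has the
  same mass under both, as the coupling along labels requires. Equal labels mean distance less than
  \<open>e\<close>.\<close>

lemma approximate_gluing:
  fixes f :: "'m \<Rightarrow> 'b::{metric_space, second_countable_topology}"
  assumes M: "prob_space M" and N: "prob_space N"
    and [measurable]: "f \<in> measurable M borel" "g \<in> measurable N borel"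
    and eq: "distr M borel f = distr N borel g" and "e > 0"
  obtains K where "prob_space K" "sets K = sets (M \<Otimes>\<^sub>M N)" "distr K M fst = M" "distr K N snd = N"
    "AE z in K. dist (f (fst z)) (g (snd z)) < e"
proof -
  obtain c :: "'b \<Rightarrow> nat" where c[measurable]: "c \<in> measurable borel (count_space UNIV)"
    and small: "\<And>x y. c x = c y \<Longrightarrow> dist x y < e"
    using countable_partition_small[OF \<open>e > 0\<close>] by blast
  have "emeasure M ((c \<circ> f) -` {n} \<inter> space M) = emeasure N ((c \<circ> g) -` {n} \<inter> space N)" for n
  proof -
    have "emeasure (distr M borel f) (c -` {n} \<inter> space borel) = emeasure (distr N borel g) (c -` {n} \<inter> space borel)"
      by (simp add: eq)
    then show ?thesis by (simp add: emeasure_distr measurable_sets[OF c] vimage_comp del: space_borel) simp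
  qed
  from coupling_along_discrete[OF M N _ _ this] obtain K where
    "prob_space K" "sets K = sets (M \<Otimes>\<^sub>M N)" "distr K M fst = M" "distr K N snd = N"
    "AE z in K. (c \<circ> f) (fst z) = (c \<circ> g) (snd z)"
    by (metis (no_types, lifting) assms(3,4) c measurable_comp)
  moreover from this(5) have "AE z in K. dist (f (fst z)) (g (snd z)) < e"
    by eventually_elim (auto intro: small)
  ultimately show ?thesis using that by blast
qed

text \<open>The coupling of \<open>M\<close> and \<open>N\<close> is itself glued to
  \<open>L\<close> through its second component. Its first marginal is the earlier coupling, so the
  laws and the closeness already obtained carry over.\<close>

lemma approximate_gluing3:
  fixes f :: "'m \<Rightarrow> 'b::{metric_space, second_countable_topology}"
    and g :: "'n \<Rightarrow> 'b" and h :: "'l \<Rightarrow> 'c::{metric_space, second_countable_topology}"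
  assumes M: "prob_space M" and N: "prob_space N" and L: "prob_space L"
    and [measurable]: "f \<in> measurable M borel" "g \<in> measurable N borel"
      "g' \<in> measurable N borel" "h \<in> measurable L borel"
    and fg: "distr M borel f = distr N borel g" and gh: "distr N borel g' = distr L borel h" and "e > 0"
  obtains K :: "(('m \<times> 'n) \<times> 'l) measure" and a b c
  where "prob_space K" "a \<in> measurable K M" "b \<in> measurable K N" "c \<in> measurable K L"
    "distr K M a = M" "distr K N b = N" "distr K L c = L"
    "AE z in K. dist (f (a z)) (g (b z)) < e" "AE z in K. dist (g' (b z)) (h (c z)) < e"
proof -
  obtain K1 where K1: "prob_space K1" and sets1[measurable_cong]: "sets K1 = sets (M \<Otimes>\<^sub>M N)"
    and d1: "distr K1 M fst = M" "distr K1 N snd = N" and ae1: "AE z in K1. dist (f (fst z)) (g (snd z)) < e"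
    using approximate_gluing[OF M N assms(4,5) fg \<open>e > 0\<close>] by blast
  have "distr K1 borel (\<lambda>z. g' (snd z)) = distr (distr K1 N snd) borel g'"
    by (simp add: distr_distr comp_def)
  then have law: "distr K1 borel (\<lambda>z. g' (snd z)) = distr L borel h"
    by (simp only: d1 gh)
  have "(\<lambda>z. g' (snd z)) \<in> measurable K1 borel" by measurable
  from approximate_gluing[OF K1 L this assms(7) law \<open>e > 0\<close>] obtain K2 where K2: "prob_space K2" and sets2[measurable_cong]: "sets K2 = sets (K1 \<Otimes>\<^sub>M L)"
    and d2: "distr K2 K1 fst = K1" "distr K2 L snd = L" and ae2: "AE z in K2. dist (g' (snd (fst z))) (h (snd z)) < e"
    by blast
  have fst_K2: "fst \<in> measurable K2 K1" by measurable
  have "distr K2 M (\<lambda>z. fst (fst z)) = distr (distr K2 K1 fst) M fst"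
    "distr K2 N (\<lambda>z. snd (fst z)) = distr (distr K2 K1 fst) N snd"
    by (simp_all add: distr_distr comp_def)
  moreover have "AE z in K2. dist (f (fst (fst z))) (g (snd (fst z))) < e"
    using ae1 by (intro AE_distrD[OF fst_K2]) (simp only: d2(1))
  ultimately show ?thesis
    using that[of K2 "\<lambda>z. fst (fst z)" "\<lambda>z. snd (fst z)" snd] K2 ae2 by (simp add: d1 d2)
qed

section \<open>Bounds in L2\<close>

text \<open>An upper bound on the L2 norm. Integrability is included because the Bochner integral of
  a non-integrable function is 0 and would meet any bound; \<open>0 \<le> c\<close> allows passing
  between squares and roots.\<close>

definition L2_le :: "'m measure \<Rightarrow> ('m \<Rightarrow> real) \<Rightarrow> real \<Rightarrow> bool" where
  "L2_le M f c \<longleftrightarrow> f \<in> borel_measurable M \<and> 0 \<le> c \<and> integrable M (\<lambda>x. (f x)\<^sup>2) \<and> (\<integral>x. (f x)\<^sup>2 \<partial>M) \<le> c\<^sup>2"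

lemma L2_le_sqrt: "f \<in> borel_measurable M \<Longrightarrow> integrable M (\<lambda>x. (f x)\<^sup>2) \<Longrightarrow> L2_le M f (sqrt (\<integral>x. (f x)\<^sup>2 \<partial>M))"
  by (simp add: L2_le_def)

lemma L2_le_distr:
  assumes "t \<in> measurable M N" "f \<in> borel_measurable N"
  shows "L2_le (distr M N t) f c \<longleftrightarrow> L2_le M (\<lambda>x. f (t x)) c"
  using assms by (simp add: L2_le_def integrable_distr_eq integral_distr)

lemma L2_le_const: "prob_space M \<Longrightarrow> 0 \<le> c \<Longrightarrow> L2_le M (\<lambda>_. c) c"
  by (simp add: L2_le_def prob_space.prob_space finite_measure.integrable_const prob_space_def)

lemma L2_le_cmult: "L2_le M f c \<Longrightarrow> 0 \<le> a \<Longrightarrow> L2_le M (\<lambda>x. a * f x) (a * c)"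
  by (auto simp: L2_le_def power_mult_distrib intro!: mult_left_mono)

lemma L2_le_mono:
  assumes "L2_le M g c" "f \<in> borel_measurable M" "AE x in M. \<bar>f x\<bar> \<le> \<bar>g x\<bar>"
  shows "L2_le M f c"
proof -
  have le: "AE x in M. (f x)\<^sup>2 \<le> (g x)\<^sup>2"
    using assms(3) by eventually_elim (simp add: abs_le_square_iff)
  have "integrable M (\<lambda>x. (f x)\<^sup>2)"
    by (rule Bochner_Integration.integrable_bound[of M "\<lambda>x. (g x)\<^sup>2"]) (use assms le in \<open>auto simp: L2_le_def\<close>)
  then show ?thesis
    using integral_mono_AE[OF _ _ le] assms unfolding L2_le_def by fastforce
qed

text \<open>Minkowski's inequality from a weighted Young inequality: if \<open>u\<close> and
  \<open>v\<close> bound the two norms, the weights \<open>1 + v / u\<close> and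
  \<open>1 + u / v\<close> make the integrated bound exactly (u + v)^2.\<close>

lemma L2_le_add:
  assumes f: "L2_le M f a" and g: "L2_le M g b"
  shows "L2_le M (\<lambda>x. f x + g x) (a + b)"
proof -
  have [measurable]: "f \<in> borel_measurable M" "g \<in> borel_measurable M"
    and int[simp]: "integrable M (\<lambda>x. (f x)\<^sup>2)" "integrable M (\<lambda>x. (g x)\<^sup>2)" and ab: "0 \<le> a" "0 \<le> b"
    using f g by (auto simp: L2_le_def)
  have le: "(f x + g x)\<^sup>2 \<le> (1 + v / u) * (f x)\<^sup>2 + (1 + u / v) * (g x)\<^sup>2" if "u > 0" "v > 0" for u v x
  proof -
    have "0 \<le> (v * f x - u * g x)\<^sup>2 / (u * v)" using that by simp
    also have "\<dots> = v / u * (f x)\<^sup>2 + u / v * (g x)\<^sup>2 - 2 * f x * g x"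
      using that by (simp add: power2_eq_square field_simps)
    finally show ?thesis by (simp add: power2_sum algebra_simps)
  qed
  have integrable: "integrable M (\<lambda>x. (f x + g x)\<^sup>2)"
    by (rule Bochner_Integration.integrable_bound[of M "\<lambda>x. (1 + 1 / 1) * (f x)\<^sup>2 + (1 + 1 / 1) * (g x)\<^sup>2"])
      (use le[of 1 1] in \<open>auto intro!: AE_I2\<close>)
  have "sqrt (\<integral>x. (f x + g x)\<^sup>2 \<partial>M) \<le> a + b + e" if "e > 0" for e
  proof -
    \<comment> \<open>The additional \<open>e / 2\<close> keeps the weights meaningful when
      \<open>a\<close> or \<open>b\<close> is 0.\<close>
    define u v where "u = a + e / 2" and "v = b + e / 2"
    have uv: "u > 0" "v > 0" using ab that by (auto simp: u_def v_def)
    have "(\<integral>x. (f x)\<^sup>2 \<partial>M) \<le> u\<^sup>2" "(\<integral>x. (g x)\<^sup>2 \<partial>M) \<le> v\<^sup>2"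
      using f g ab that power_mono[of a u 2] power_mono[of b v 2]
      unfolding L2_le_def u_def v_def by (simp_all add: order_trans[OF _ power_mono])
    then have "(1 + v / u) * (\<integral>x. (f x)\<^sup>2 \<partial>M) + (1 + u / v) * (\<integral>x. (g x)\<^sup>2 \<partial>M) \<le> (1 + v / u) * u\<^sup>2 + (1 + u / v) * v\<^sup>2"
      using uv by (intro add_mono mult_left_mono) auto
    also have "\<dots> = (u + v)\<^sup>2" using uv by (simp add: power2_eq_square field_simps)
    finally have "(\<integral>x. (1 + v / u) * (f x)\<^sup>2 + (1 + u / v) * (g x)\<^sup>2 \<partial>M) \<le> (u + v)\<^sup>2"
      by simp
    moreover have "(\<integral>x. (f x + g x)\<^sup>2 \<partial>M) \<le> (\<integral>x. (1 + v / u) * (f x)\<^sup>2 + (1 + u / v) * (g x)\<^sup>2 \<partial>M)"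
      using le[OF uv] integrable by (intro integral_mono) auto
    ultimately have "(\<integral>x. (f x + g x)\<^sup>2 \<partial>M) \<le> (u + v)\<^sup>2" by linarith
    moreover have "u + v = a + b + e" by (simp add: u_def v_def)
    ultimately show ?thesis using ab that by (simp add: real_le_lsqrt)
  qed
  then have "sqrt (\<integral>x. (f x + g x)\<^sup>2 \<partial>M) \<le> a + b" by (rule field_le_epsilon)
  then show ?thesis using integrable ab by (simp add: L2_le_def sqrt_le_D)
qed

lemma L2_le_weaken: "L2_le M f c \<Longrightarrow> c \<le> d \<Longrightarrow> L2_le M f d"
  unfolding L2_le_def by (meson order_trans power_mono)

lemma L2_le_imp_sqrt_le: "L2_le M f c \<Longrightarrow> sqrt (\<integral>x. (f x)\<^sup>2 \<partial>M) \<le> c"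
  by (simp add: L2_le_def real_le_lsqrt)

section \<open>Transport plans\<close>

lemma measurable_fst_snd_borel [measurable]:
  "(fst :: 'a::second_countable_topology \<times> 'b::second_countable_topology \<Rightarrow> 'a) \<in> measurable borel borel"
  "(snd :: 'a::second_countable_topology \<times> 'b::second_countable_topology \<Rightarrow> 'b) \<in> measurable borel borel"
  by (simp_all flip: borel_prod)

lemma transport_plan_distr:
  assumes "\<gamma> \<in> transport_plans \<mu> \<nu>"
  shows "prob_space \<gamma>" "sets \<gamma> = sets (borel \<Otimes>\<^sub>M borel)" "distr \<gamma> borel fst = \<mu>" "distr \<gamma> borel snd = \<nu>"
  using assms unfolding transport_plans_def mem_Collect_eq borel_prod by blast+

lemma P2_D:
  assumes "\<mu> \<in> P2"
  shows "prob_space \<mu>" "sets \<mu> = sets borel" "integrable \<mu> (\<lambda>x. (norm x)\<^sup>2)"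
  using assms unfolding P2_def mem_Collect_eq by blast+

lemma sq_norm_diff_le: "(norm (x - y))\<^sup>2 \<le> 2 * (norm x)\<^sup>2 + 2 * (norm (y :: 'a::euclidean_space))\<^sup>2"
proof -
  have "0 \<le> (norm (x + y))\<^sup>2" by simp
  then show ?thesis
    by (simp add: power2_norm_eq_inner inner_add_left inner_add_right inner_diff_left inner_diff_right inner_commute)
qed

lemma integrable_sq_norm_diff:
  fixes f g :: "'m \<Rightarrow> 'a::euclidean_space"
  assumes [measurable]: "f \<in> borel_measurable M" "g \<in> borel_measurable M"
    and "integrable M (\<lambda>x. (norm (f x))\<^sup>2)" "integrable M (\<lambda>x. (norm (g x))\<^sup>2)"
  shows "integrable M (\<lambda>x. (norm (f x - g x))\<^sup>2)"
proof (rule Bochner_Integration.integrable_bound)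
  show "integrable M (\<lambda>x. 2 * (norm (f x))\<^sup>2 + 2 * (norm (g x))\<^sup>2)" using assms(3,4) by simp
  show "AE x in M. norm ((norm (f x - g x))\<^sup>2) \<le> norm (2 * (norm (f x))\<^sup>2 + 2 * (norm (g x))\<^sup>2)"
    using sq_norm_diff_le[of "f _" "g _"] by simp
qed measurable

lemma transport_plan_integrable:
  assumes \<gamma>: "\<gamma> \<in> transport_plans \<mu> \<nu>" and "\<mu> \<in> P2" "\<nu> \<in> P2"
  shows "integrable \<gamma> (\<lambda>z. (norm (fst z))\<^sup>2)" "integrable \<gamma> (\<lambda>z. (norm (snd z))\<^sup>2)"
    "integrable \<gamma> (\<lambda>z. (norm (fst z - snd z))\<^sup>2)"
proof -
  note [measurable_cong] = transport_plan_distr(2)[OF \<gamma>]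
  have "integrable (distr \<gamma> borel fst) (\<lambda>x. (norm x)\<^sup>2)" "integrable (distr \<gamma> borel snd) (\<lambda>x. (norm x)\<^sup>2)"
    using P2_D(3)[OF assms(2)] P2_D(3)[OF assms(3)] by (simp_all only: transport_plan_distr(3,4)[OF \<gamma>])
  then show "integrable \<gamma> (\<lambda>z. (norm (fst z))\<^sup>2)" "integrable \<gamma> (\<lambda>z. (norm (snd z))\<^sup>2)"
    by (simp_all add: integrable_distr_eq)
  then show "integrable \<gamma> (\<lambda>z. (norm (fst z - snd z))\<^sup>2)"
    by (intro integrable_sq_norm_diff) measurable
qed

lemma plan_cost_eq_integral:
  assumes "\<gamma> \<in> transport_plans \<mu> \<nu>" "\<mu> \<in> P2" "\<nu> \<in> P2"
  shows "plan_cost \<gamma> = ennreal (\<integral>z. (norm (fst z - snd z))\<^sup>2 \<partial>\<gamma>)"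
  unfolding plan_cost_def split_def
  by (intro nn_integral_eq_integral transport_plan_integrable[OF assms]) simp

lemma L2_le_transport_plan:
  assumes "\<gamma> \<in> transport_plans \<mu> \<nu>" "\<mu> \<in> P2" "\<nu> \<in> P2"
  shows "L2_le \<gamma> (\<lambda>z. norm (fst z - snd z)) (sqrt (\<integral>z. (norm (fst z - snd z))\<^sup>2 \<partial>\<gamma>))"
proof -
  note [measurable_cong] = transport_plan_distr(2)[OF assms(1)]
  show ?thesis by (intro L2_le_sqrt transport_plan_integrable(3)[OF assms]) measurable
qed

lemma W2_square_le:
  assumes "\<gamma> \<in> transport_plans \<mu> \<nu>" "\<mu> \<in> P2" "\<nu> \<in> P2"
  shows "(W2 \<mu> \<nu>)\<^sup>2 \<le> (\<integral>z. (norm (fst z - snd z))\<^sup>2 \<partial>\<gamma>)"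
proof -
  have "(INF \<gamma> \<in> transport_plans \<mu> \<nu>. plan_cost \<gamma>) \<le> ennreal (\<integral>z. (norm (fst z - snd z))\<^sup>2 \<partial>\<gamma>)"
    using plan_cost_eq_integral[OF assms] assms(1) by (metis INF_lower)
  then show ?thesis unfolding W2_def by (simp add: enn2real_leI)
qed

lemma W2_nonneg: "0 \<le> W2 \<mu> \<nu>"
  by (simp add: W2_def)

text \<open>A near-minimiser serves as an optimal plan up to \<open>e\<close>. Plans between
  measures in \<open>P2\<close> have finite cost, so the infimum is below \<open>top\<close> and
  \<open>enn2real\<close> in \<open>W2\<close> loses nothing.\<close>

lemma W2_approx:
  assumes "\<mu> \<in> P2" "\<nu> \<in> P2" "transport_plans \<mu> \<nu> \<noteq> {}" "e > 0"
  obtains \<sigma> where "\<sigma> \<in> transport_plans \<mu> \<nu>" "sqrt (\<integral>z. (norm (fst z - snd z))\<^sup>2 \<partial>\<sigma>) \<le> W2 \<mu> \<nu> + e"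
proof -
  let ?I = "INF \<gamma> \<in> transport_plans \<mu> \<nu>. plan_cost \<gamma>"
  obtain \<gamma> where \<gamma>: "\<gamma> \<in> transport_plans \<mu> \<nu>" using assms by auto
  have "?I \<le> plan_cost \<gamma>" using \<gamma> by (rule INF_lower)
  then have "?I < top" by (simp add: plan_cost_eq_integral[OF \<gamma> assms(1,2)] le_less_trans)
  then have I: "?I = ennreal ((W2 \<mu> \<nu>)\<^sup>2)" unfolding W2_def by simp
  also have "\<dots> < ennreal ((W2 \<mu> \<nu> + e)\<^sup>2)"
    using assms(4) W2_nonneg[of \<mu> \<nu>] by (simp add: ennreal_less_iff power_strict_mono)
  finally obtain \<sigma> where \<sigma>: "\<sigma> \<in> transport_plans \<mu> \<nu>" "plan_cost \<sigma> < ennreal ((W2 \<mu> \<nu> + e)\<^sup>2)"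
    by (auto simp: INF_less_iff)
  then have "(\<integral>z. (norm (fst z - snd z))\<^sup>2 \<partial>\<sigma>) \<le> (W2 \<mu> \<nu> + e)\<^sup>2"
    by (simp add: plan_cost_eq_integral[OF \<sigma>(1) assms(1,2)] ennreal_less_iff)
  then show ?thesis
    using that \<sigma>(1) assms(4) W2_nonneg[of \<mu> \<nu>] by (simp add: real_le_lsqrt)
qed

lemma transport_plan_of_map:
  assumes \<mu>: "\<mu> \<in> P2" and [measurable]: "T \<in> borel_measurable borel" and "distr \<mu> borel T = \<nu>"
  shows "distr \<mu> borel (\<lambda>x. (x, T x)) \<in> transport_plans \<mu> \<nu>"
proof -
  interpret prob_space \<mu> by (rule P2_D(1)[OF \<mu>])
  note [measurable_cong] = P2_D(2)[OF \<mu>]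
  have "distr \<mu> borel (\<lambda>x. x) = \<mu>"
    by (rule distr_id2) (simp add: P2_D(2)[OF \<mu>])
  then show ?thesis
    using assms(3) by (simp add: transport_plans_def prob_space_distr distr_distr comp_def)
qed

lemma transport_plan_swap:
  assumes \<gamma>: "\<gamma> \<in> transport_plans \<mu> \<nu>"
  shows "distr \<gamma> borel prod.swap \<in> transport_plans \<nu> \<mu>"
    "L2_le (distr \<gamma> borel prod.swap) (\<lambda>z. norm (fst z - snd z)) c \<longleftrightarrow> L2_le \<gamma> (\<lambda>z. norm (fst z - snd z)) c"
proof -
  interpret prob_space \<gamma> by (rule transport_plan_distr(1)[OF \<gamma>])
  note [measurable_cong] = transport_plan_distr(2)[OF \<gamma>]
  have [measurable]: "prod.swap \<in> measurable \<gamma> borel"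
    unfolding borel_prod[symmetric] prod.swap_def by measurable
  show "distr \<gamma> borel prod.swap \<in> transport_plans \<nu> \<mu>"
    using transport_plan_distr[OF \<gamma>] by (simp add: transport_plans_def prob_space_distr distr_distr comp_def)
  show "L2_le (distr \<gamma> borel prod.swap) (\<lambda>z. norm (fst z - snd z)) c \<longleftrightarrow> L2_le \<gamma> (\<lambda>z. norm (fst z - snd z)) c"
    by (subst L2_le_distr) (simp_all add: norm_minus_commute)
qed

section \<open>Stability of the optimal map under plans, and its transfer to perturbed
  marginals\<close>

text \<open>\<open>gradient_gap_le\<close> is integrated against \<gamma>. The image of the first
  variable under the gradient has the law of the second variable, so the squared norms and the
  conjugate terms cancel. The plan on the graph of the gradient is a competitor for
  \<open>W2\<close>, which bounds the remaining negative term.\<close>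

lemma gradient_plan_stability:
  fixes \<phi> :: "'a::euclidean_space \<Rightarrow> real"
  assumes lam: "lam > 0" and convex: "convex_on UNIV \<phi>" and smooth: "smooth_with lam \<phi>"
    and \<mu>: "\<mu> \<in> P2" and \<nu>: "\<nu> \<in> P2" and push: "distr \<mu> borel (gradient \<phi>) = \<nu>"
    and \<gamma>: "\<gamma> \<in> transport_plans \<mu> \<nu>"
  shows "integrable \<gamma> (\<lambda>z. (norm (gradient \<phi> (fst z) - snd z))\<^sup>2)"
    "(\<integral>z. (norm (gradient \<phi> (fst z) - snd z))\<^sup>2 \<partial>\<gamma>)
      \<le> lam * ((\<integral>z. (norm (fst z - snd z))\<^sup>2 \<partial>\<gamma>) - (W2 \<mu> \<nu>)\<^sup>2)"
proof -
  note grad = gradient_lower[OF lam convex smooth] gradient_upper[OF lam convex smooth]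
  let ?T = "gradient \<phi>"
  interpret prob_space \<gamma> by (rule transport_plan_distr(1)[OF \<gamma>])
  have [measurable]: "?T \<in> borel_measurable borel" "\<phi> \<in> borel_measurable borel"
    using gradient_continuous[OF lam convex smooth] potential_continuous[OF lam convex smooth]
    by (auto intro: borel_measurable_continuous_onI)
  note [measurable_cong] = transport_plan_distr(2)[OF \<gamma>] P2_D(2)[OF \<mu>] P2_D(2)[OF \<nu>]
  note plan = transport_plan_distr[OF \<gamma>]
  have [simp]: "integrable \<gamma> (\<lambda>z. (norm (fst z))\<^sup>2)" "integrable \<gamma> (\<lambda>z. (norm (snd z))\<^sup>2)"
    "integrable \<gamma> (\<lambda>z. (norm (fst z - snd z))\<^sup>2)"
    using transport_plan_integrable[OF \<gamma> \<mu> \<nu>] .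
  have "distr \<gamma> borel (\<lambda>z. ?T (fst z)) = distr (distr \<gamma> borel fst) borel ?T"
    by (simp add: distr_distr comp_def)
  then have law: "distr \<gamma> borel (\<lambda>z. ?T (fst z)) = distr \<gamma> borel snd"
    by (simp only: plan(3,4) push)
  have transfer: "integrable \<gamma> (\<lambda>z. f (?T (fst z))) \<longleftrightarrow> integrable \<gamma> (\<lambda>z. f (snd z))"
      "(\<integral>z. f (?T (fst z)) \<partial>\<gamma>) = (\<integral>z. f (snd z) \<partial>\<gamma>)"
    if [measurable]: "f \<in> borel_measurable borel" for f :: "'a \<Rightarrow> real"
    using arg_cong[OF law, of "\<lambda>M. integrable M f"] arg_cong[OF law, of "\<lambda>M. integral\<^sup>L M f"]
    by (simp_all add: integrable_distr_eq integral_distr)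
  have [simp]: "integrable \<gamma> (\<lambda>z. (norm (?T (fst z)))\<^sup>2)"
    by (simp add: transfer(1)[of "\<lambda>y. (norm y)\<^sup>2"])
  have [simp]: "integrable \<gamma> (\<lambda>z. (norm (fst z - ?T (fst z)))\<^sup>2)"
    by (intro integrable_sq_norm_diff) simp_all
  show int[simp]: "integrable \<gamma> (\<lambda>z. (norm (?T (fst z) - snd z))\<^sup>2)"
    by (intro integrable_sq_norm_diff) simp_all
  obtain \<psi> S where [measurable]: "\<psi> \<in> borel_measurable borel" "S \<in> sets borel"
    and S: "\<And>x. ?T x \<in> S" and \<psi>: "\<And>x. \<psi> (?T x) = x \<bullet> ?T x - \<phi> x" "\<And>y z. y \<in> S \<Longrightarrow> z \<bullet> y - \<phi> z \<le> \<psi> y"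
    using conjugate_on_gradient_range[OF lam convex smooth] by blast
  have inner_abs: "\<bar>x \<bullet> y\<bar> \<le> (norm x)\<^sup>2 + (norm y)\<^sup>2" for x y :: 'a
  proof -
    have "0 \<le> (norm (x + y))\<^sup>2" "0 \<le> (norm (x - y))\<^sup>2" "0 \<le> x \<bullet> x" "0 \<le> y \<bullet> y" by simp_all
    then show ?thesis
      by (simp add: power2_norm_eq_inner inner_add_left inner_add_right inner_diff_left inner_diff_right inner_commute)
  qed
  have "integrable \<gamma> (\<lambda>z. \<psi> (?T (fst z)))"
  proof (rule Bochner_Integration.integrable_bound)
    \<comment> \<open>Affine and quadratic bounds at 0 control \<open>\<phi> x\<close>, and
      \<open>inner_abs\<close> controls both inner products. Integrability of the conjugate is what
      permits splitting the integral and cancelling.\<close>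
    let ?b = "\<lambda>z. (norm (fst z))\<^sup>2 + (norm (fst z))\<^sup>2 + lam / 2 * (norm (fst z))\<^sup>2 + (norm (?T (fst z)))\<^sup>2 + (norm (?T 0))\<^sup>2 + \<bar>\<phi> 0\<bar>"
    show "integrable \<gamma> ?b" by simp
    have bound: "\<bar>x \<bullet> ?T x - \<phi> x\<bar> \<le> ?b (x, y)" for x y :: 'a
    proof -
      have "\<bar>\<phi> x\<bar> \<le> \<bar>\<phi> 0\<bar> + \<bar>?T 0 \<bullet> x\<bar> + lam / 2 * (norm x)\<^sup>2"
      proof -
        have "\<phi> 0 + ?T 0 \<bullet> x \<le> \<phi> x" "\<phi> x \<le> \<phi> 0 + ?T 0 \<bullet> x + lam / 2 * (norm x)\<^sup>2"
          using grad(1)[of 0 x] grad(2)[of x 0] by simp_all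
        moreover have "0 \<le> lam / 2 * (norm x)\<^sup>2" using lam by simp
        ultimately show ?thesis by linarith
      qed
      moreover have "\<bar>x \<bullet> ?T x - \<phi> x\<bar> \<le> \<bar>x \<bullet> ?T x\<bar> + \<bar>\<phi> x\<bar>" by (rule abs_triangle_ineq4)
      ultimately show ?thesis
        using inner_abs[of x "?T x"] inner_abs[of "?T 0" x] unfolding fst_conv by linarith
    qed
    have "norm (\<psi> (?T (fst z))) \<le> norm (?b z)" for z :: "'a \<times> 'a"
      using order_trans[OF bound[of "fst z" "snd z"] abs_ge_self] by (simp only: \<psi>(1) real_norm_def prod.collapse)
    then show "AE z in \<gamma>. norm (\<psi> (?T (fst z))) \<le> norm (?b z)" by simp
  qed simp
  then have [simp]: "integrable \<gamma> (\<lambda>z. \<psi> (?T (fst z)))" "integrable \<gamma> (\<lambda>z. \<psi> (snd z))"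
    using transfer(1)[of \<psi>] by simp_all
  \<comment> \<open>\<open>S\<close> contains every gradient, and \<open>snd\<close> has the law of
    a gradient, so almost every second variable lies where the conjugate is finite.\<close>
  have "AE y in distr \<gamma> borel snd. y \<in> S"
    unfolding law[symmetric] by (subst AE_distr_iff) (simp_all add: S)
  then have AE_S: "AE z in \<gamma>. snd z \<in> S" by (subst (asm) AE_distr_iff) simp_all
  have key: "(norm (?T x - y))\<^sup>2 \<le> lam * ((norm (x - y))\<^sup>2 - (norm (x - ?T x))\<^sup>2 - (norm y)\<^sup>2 + (norm (?T x))\<^sup>2
      + 2 * \<psi> y - 2 * \<psi> (?T x))" if "y \<in> S" for x y
    unfolding \<psi>(1) by (rule gradient_gap_le[OF lam convex smooth \<psi>(2)[OF that]])
  have "(\<integral>z. (norm (?T (fst z) - snd z))\<^sup>2 \<partial>\<gamma>) \<le> (\<integral>z. lam * ((norm (fst z - snd z))\<^sup>2 - (norm (fst z - ?T (fst z)))\<^sup>2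
      - (norm (snd z))\<^sup>2 + (norm (?T (fst z)))\<^sup>2 + 2 * \<psi> (snd z) - 2 * \<psi> (?T (fst z))) \<partial>\<gamma>)"
    using AE_S by (intro integral_mono_AE) (auto elim!: eventually_mono intro: key)
  also have "\<dots> = lam * ((\<integral>z. (norm (fst z - snd z))\<^sup>2 \<partial>\<gamma>) - (\<integral>z. (norm (fst z - ?T (fst z)))\<^sup>2 \<partial>\<gamma>))"
    using transfer(2)[of \<psi>] transfer(2)[of "\<lambda>y. (norm y)\<^sup>2"] by simp
  also have "\<dots> \<le> lam * ((\<integral>z. (norm (fst z - snd z))\<^sup>2 \<partial>\<gamma>) - (W2 \<mu> \<nu>)\<^sup>2)"
  proof -
    have "(W2 \<mu> \<nu>)\<^sup>2 \<le> (\<integral>z. (norm (fst z - snd z))\<^sup>2 \<partial>distr \<mu> borel (\<lambda>x. (x, ?T x)))"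
      by (intro W2_square_le transport_plan_of_map \<mu> \<nu> push) measurable
    also have "\<dots> = (\<integral>z. (norm (fst z - ?T (fst z)))\<^sup>2 \<partial>\<gamma>)"
      by (subst plan(3)[symmetric]) (simp add: distr_distr integral_distr comp_def)
    finally show ?thesis using lam by (intro mult_left_mono) auto
  qed
  finally show "(\<integral>z. (norm (?T (fst z) - snd z))\<^sup>2 \<partial>\<gamma>) \<le> lam * ((\<integral>z. (norm (fst z - snd z))\<^sup>2 \<partial>\<gamma>) - (W2 \<mu> \<nu>)\<^sup>2)" .
qed

text \<open>The triangle inequality along the glued chain, combined with Minkowski: three plan
  distances plus an error \<open>e\<close> at each of the two joints. The joint space
  \<open>K\<close> is exposed as well, since the final estimate also needs the inner
  variables.\<close>

lemma transport_plan_chain: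
  fixes \<alpha> \<gamma> \<beta> :: "('a::euclidean_space \<times> 'a) measure"
  assumes \<alpha>: "\<alpha> \<in> transport_plans \<mu>1 \<mu>2" and \<gamma>: "\<gamma> \<in> transport_plans \<mu>2 \<mu>3" and \<beta>: "\<beta> \<in> transport_plans \<mu>3 \<mu>4"
    and bounds: "L2_le \<alpha> (\<lambda>z. norm (fst z - snd z)) A" "L2_le \<gamma> (\<lambda>z. norm (fst z - snd z)) C"
      "L2_le \<beta> (\<lambda>z. norm (fst z - snd z)) B"
    and "e > 0"
  obtains K :: "((('a \<times> 'a) \<times> ('a \<times> 'a)) \<times> ('a \<times> 'a)) measure" and a b c
  where "prob_space K" "a \<in> measurable K (borel \<Otimes>\<^sub>M borel)" "b \<in> measurable K (borel \<Otimes>\<^sub>M borel)" "c \<in> measurable K (borel \<Otimes>\<^sub>M borel)"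
    "distr K borel a = \<alpha>" "distr K borel b = \<gamma>" "distr K borel c = \<beta>"
    "AE z in K. norm (snd (a z) - fst (b z)) < e" "AE z in K. norm (snd (b z) - fst (c z)) < e"
    "distr K borel (\<lambda>z. (fst (a z), snd (c z))) \<in> transport_plans \<mu>1 \<mu>4"
    "L2_le (distr K borel (\<lambda>z. (fst (a z), snd (c z)))) (\<lambda>z. norm (fst z - snd z)) (A + B + C + 2 * e)"
proof -
  note [measurable_cong] = transport_plan_distr(2)[OF \<alpha>] transport_plan_distr(2)[OF \<beta>] transport_plan_distr(2)[OF \<gamma>]
  have m: "snd \<in> measurable \<alpha> borel" "fst \<in> measurable \<gamma> borel" "snd \<in> measurable \<gamma> borel" "fst \<in> measurable \<beta> borel"
    by measurable
  have "distr \<alpha> borel snd = distr \<gamma> borel fst" "distr \<gamma> borel snd = distr \<beta> borel fst"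
    using \<alpha> \<beta> \<gamma> by (auto simp: transport_plans_def)
  from approximate_gluing3[OF transport_plan_distr(1)[OF \<alpha>] transport_plan_distr(1)[OF \<gamma>] transport_plan_distr(1)[OF \<beta>]
      m this \<open>e > 0\<close>]
  obtain K :: "((('a \<times> 'a) \<times> ('a \<times> 'a)) \<times> ('a \<times> 'a)) measure" and a b c where K: "prob_space K"
    and abc: "a \<in> measurable K \<alpha>" "b \<in> measurable K \<gamma>" "c \<in> measurable K \<beta>"
    and d: "distr K \<alpha> a = \<alpha>" "distr K \<gamma> b = \<gamma>" "distr K \<beta> c = \<beta>"
    and ae: "AE z in K. dist (snd (a z)) (fst (b z)) < e" "AE z in K. dist (snd (b z)) (fst (c z)) < e"
    by blast
  interpret prob_space K by fact
  have abc'[measurable]: "a \<in> measurable K (borel \<Otimes>\<^sub>M borel)" "b \<in> measurable K (borel \<Otimes>\<^sub>M borel)" "c \<in> measurable K (borel \<Otimes>\<^sub>M borel)"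
    using abc transport_plan_distr(2)[OF \<alpha>] transport_plan_distr(2)[OF \<beta>] transport_plan_distr(2)[OF \<gamma>]
    unfolding measurable_cong_sets[OF refl transport_plan_distr(2)[OF \<alpha>]]
      measurable_cong_sets[OF refl transport_plan_distr(2)[OF \<gamma>]] measurable_cong_sets[OF refl transport_plan_distr(2)[OF \<beta>]]
    by blast+
  have d': "distr K borel a = \<alpha>" "distr K borel b = \<gamma>" "distr K borel c = \<beta>"
    using d distr_cong[OF refl transport_plan_distr(2)[OF \<alpha>] refl, of K a] distr_cong[OF refl transport_plan_distr(2)[OF \<gamma>] refl, of K b]
      distr_cong[OF refl transport_plan_distr(2)[OF \<beta>] refl, of K c]
    by (simp_all only: borel_prod)
  have law: "distr K borel (\<lambda>z. fst (a z)) = \<mu>1" "distr K borel (\<lambda>z. snd (c z)) = \<mu>4"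
    using transport_plan_distr(3)[OF \<alpha>] transport_plan_distr(4)[OF \<beta>]
    unfolding d'[symmetric] by (simp_all add: distr_distr comp_def borel_prod[symmetric])
  let ?P = "distr K borel (\<lambda>z. (fst (a z), snd (c z)))"
  have P: "?P \<in> transport_plans \<mu>1 \<mu>4"
    using law by (simp add: transport_plans_def prob_space_distr distr_distr comp_def)
  have "L2_le K (\<lambda>z. norm (fst (a z) - snd (a z))) A" "L2_le K (\<lambda>z. norm (fst (b z) - snd (b z))) C"
    "L2_le K (\<lambda>z. norm (fst (c z) - snd (c z))) B"
    using bounds unfolding d'[symmetric] by (simp_all add: L2_le_distr borel_prod[symmetric])
  then have "L2_le K (\<lambda>z. norm (fst (a z) - snd (a z)) + norm (fst (c z) - snd (c z)) + norm (fst (b z) - snd (b z)) + 2 * e)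
      (A + B + C + 2 * e)"
    using \<open>e > 0\<close> K by (intro L2_le_add L2_le_const) auto
  then have "L2_le K (\<lambda>z. norm (fst (a z) - snd (c z))) (A + B + C + 2 * e)"
  proof (rule L2_le_mono)
    show "AE z in K. \<bar>norm (fst (a z) - snd (c z))\<bar>
      \<le> \<bar>norm (fst (a z) - snd (a z)) + norm (fst (c z) - snd (c z)) + norm (fst (b z) - snd (b z)) + 2 * e\<bar>"
      using ae
    proof eventually_elim
      case (elim z)
      have "dist (fst (a z)) (snd (c z)) \<le> dist (fst (a z)) (snd (a z)) + dist (snd (a z)) (fst (b z))
          + dist (fst (b z)) (snd (b z)) + dist (snd (b z)) (fst (c z)) + dist (fst (c z)) (snd (c z))"
        using dist_triangle[of "fst (a z)" "snd (c z)" "snd (a z)"] dist_triangle[of "snd (a z)" "snd (c z)" "fst (b z)"]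
          dist_triangle[of "fst (b z)" "snd (c z)" "snd (b z)"] dist_triangle[of "snd (b z)" "snd (c z)" "fst (c z)"] by linarith
      with elim show ?case by (simp add: dist_norm)
    qed
  qed measurable
  then have "L2_le ?P (\<lambda>z. norm (fst z - snd z)) (A + B + C + 2 * e)"
    by (subst L2_le_distr) (simp_all add: borel_prod[symmetric])
  with that[of K a b c] K abc' d' ae P show ?thesis by (simp add: dist_norm)
qed

text \<open>A competitor for \<gamma> goes from \<mu>' to \<mu> by \<alpha> reversed, on to \<nu> by
  a nearly optimal plan, and then to \<nu>' by \<beta> reversed.\<close>

lemma optimal_plan_cost_le:
  assumes \<mu>: "\<mu> \<in> P2" and \<nu>: "\<nu> \<in> P2" and \<mu>': "\<mu>' \<in> P2" and \<nu>': "\<nu>' \<in> P2"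
    and \<alpha>: "\<alpha> \<in> transport_plans \<mu> \<mu>'" and \<beta>: "\<beta> \<in> transport_plans \<nu>' \<nu>"
    and bounds: "L2_le \<alpha> (\<lambda>z. norm (fst z - snd z)) A" "L2_le \<beta> (\<lambda>z. norm (fst z - snd z)) B"
    and opt: "optimal_plan \<mu>' \<nu>' \<gamma>" and ne: "transport_plans \<mu> \<nu> \<noteq> {}"
  shows "L2_le \<gamma> (\<lambda>z. norm (fst z - snd z)) (A + B + W2 \<mu> \<nu>)"
proof -
  have \<gamma>: "\<gamma> \<in> transport_plans \<mu>' \<nu>'" using opt by (simp add: optimal_plan_def)
  have "sqrt (\<integral>z. (norm (fst z - snd z))\<^sup>2 \<partial>\<gamma>) \<le> A + B + W2 \<mu> \<nu> + e" if "e > 0" for e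
  proof -
    \<comment> \<open>One third of \<open>e\<close> pays for near-optimality, the other two for the
      two joints of the gluing.\<close>
    obtain \<sigma> where \<sigma>: "\<sigma> \<in> transport_plans \<mu> \<nu>" "sqrt (\<integral>z. (norm (fst z - snd z))\<^sup>2 \<partial>\<sigma>) \<le> W2 \<mu> \<nu> + e / 3"
      using W2_approx[OF \<mu> \<nu> ne, of "e / 3"] \<open>e > 0\<close> by auto
    have \<sigma>_le: "L2_le \<sigma> (\<lambda>z. norm (fst z - snd z)) (W2 \<mu> \<nu> + e / 3)"
      using L2_le_weaken[OF L2_le_transport_plan[OF \<sigma>(1) \<mu> \<nu>] \<sigma>(2)] .
    have "e / 3 > 0" using \<open>e > 0\<close> by simp
    from transport_plan_chain[OF transport_plan_swap(1)[OF \<alpha>] \<sigma>(1) transport_plan_swap(1)[OF \<beta>]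
        transport_plan_swap(2)[OF \<alpha>, THEN iffD2, OF bounds(1)] \<sigma>_le
        transport_plan_swap(2)[OF \<beta>, THEN iffD2, OF bounds(2)] this]
    obtain \<delta> where \<delta>: "\<delta> \<in> transport_plans \<mu>' \<nu>'"
      and \<delta>_le: "L2_le \<delta> (\<lambda>z. norm (fst z - snd z)) (A + B + (W2 \<mu> \<nu> + e / 3) + 2 * (e / 3))"
      by blast
    have "plan_cost \<gamma> \<le> plan_cost \<delta>" using opt \<delta> by (simp add: optimal_plan_def)
    then have "(\<integral>z. (norm (fst z - snd z))\<^sup>2 \<partial>\<gamma>) \<le> (\<integral>z. (norm (fst z - snd z))\<^sup>2 \<partial>\<delta>)"
      by (simp add: plan_cost_eq_integral[OF \<gamma> \<mu>' \<nu>'] plan_cost_eq_integral[OF \<delta> \<mu>' \<nu>'])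
    then have "sqrt (\<integral>z. (norm (fst z - snd z))\<^sup>2 \<partial>\<gamma>) \<le> sqrt (\<integral>z. (norm (fst z - snd z))\<^sup>2 \<partial>\<delta>)" by simp
    also have "\<dots> \<le> A + B + (W2 \<mu> \<nu> + e / 3) + 2 * (e / 3)" by (rule L2_le_imp_sqrt_le[OF \<delta>_le])
    finally show ?thesis by simp
  qed
  then have "sqrt (\<integral>z. (norm (fst z - snd z))\<^sup>2 \<partial>\<gamma>) \<le> A + B + W2 \<mu> \<nu>" by (rule field_le_epsilon)
  then show ?thesis by (rule L2_le_weaken[OF L2_le_transport_plan[OF \<gamma> \<mu>' \<nu>']])
qed

lemma gradient_plan_error:
  fixes \<phi> :: "'a::euclidean_space \<Rightarrow> real"
  assumes lam: "lam > 0" and convex: "convex_on UNIV \<phi>" and smooth: "smooth_with lam \<phi>"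
    and \<mu>: "\<mu> \<in> P2" and \<nu>: "\<nu> \<in> P2" and \<mu>': "\<mu>' \<in> P2" and \<nu>': "\<nu>' \<in> P2"
    and push: "distr \<mu> borel (gradient \<phi>) = \<nu>"
    and \<alpha>: "\<alpha> \<in> transport_plans \<mu> \<mu>'" and \<beta>: "\<beta> \<in> transport_plans \<nu>' \<nu>"
    and bounds: "L2_le \<alpha> (\<lambda>z. norm (fst z - snd z)) A" "L2_le \<beta> (\<lambda>z. norm (fst z - snd z)) B"
    and opt: "optimal_plan \<mu>' \<nu>' \<gamma>"
  shows "L2_le \<gamma> (\<lambda>z. norm (gradient \<phi> (fst z) - snd z))
    (2 * sqrt lam * sqrt (A + B) * sqrt (W2 \<mu> \<nu> + (A + B)) + lam * A + B)"
proof -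
  let ?T = "gradient \<phi>" and ?W = "W2 \<mu> \<nu>"
  \<comment> \<open>The target bound with \<open>A + B\<close> enlarged to \<open>A + B + e\<close>
    under the roots, because the chain costs W + 2 (A + B + e). The terms \<open>lam * e\<close> and
    \<open>e\<close> pay for the joints at \<mu>' and \<nu>' on the way back to \<gamma>.\<close>
  define R where "R e = 2 * sqrt lam * sqrt (A + B + e) * sqrt (?W + (A + B + e)) + lam * A + B + lam * e + e" for e
  have AB: "0 \<le> A" "0 \<le> B" using bounds by (auto simp: L2_le_def)
  have [measurable]: "?T \<in> borel_measurable borel"
    using gradient_continuous[OF lam convex smooth] by (rule borel_measurable_continuous_onI)
  have \<gamma>: "\<gamma> \<in> transport_plans \<mu>' \<nu>'" using opt by (simp add: optimal_plan_def)
  have "transport_plans \<mu> \<nu> \<noteq> {}"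
    using transport_plan_of_map[OF \<mu> _ push] by auto
  note \<gamma>_le = optimal_plan_cost_le[OF \<mu> \<nu> \<mu>' \<nu>' \<alpha> \<beta> bounds opt this]
  have approx: "L2_le \<gamma> (\<lambda>z. norm (?T (fst z) - snd z)) (R e)" if "e > 0" for e
  proof -
    from transport_plan_chain[OF \<alpha> \<gamma> \<beta> bounds(1) \<gamma>_le bounds(2) \<open>e > 0\<close>]
    obtain K :: "((('a \<times> 'a) \<times> ('a \<times> 'a)) \<times> ('a \<times> 'a)) measure" and a b c where K: "prob_space K"
      and [measurable]: "a \<in> measurable K (borel \<Otimes>\<^sub>M borel)" "b \<in> measurable K (borel \<Otimes>\<^sub>M borel)" "c \<in> measurable K (borel \<Otimes>\<^sub>M borel)"
      and d: "distr K borel a = \<alpha>" "distr K borel b = \<gamma>" "distr K borel c = \<beta>"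
      and ae: "AE z in K. norm (snd (a z) - fst (b z)) < e" "AE z in K. norm (snd (b z) - fst (c z)) < e"
      and P: "distr K borel (\<lambda>z. (fst (a z), snd (c z))) \<in> transport_plans \<mu> \<nu>" (is "?P \<in> _")
      and P_le: "L2_le (distr K borel (\<lambda>z. (fst (a z), snd (c z)))) (\<lambda>z. norm (fst z - snd z)) (A + B + (A + B + ?W) + 2 * e)"
      by blast
    have d': "\<alpha> = distr K (borel \<Otimes>\<^sub>M borel) a" "\<gamma> = distr K (borel \<Otimes>\<^sub>M borel) b" "\<beta> = distr K (borel \<Otimes>\<^sub>M borel) c"
      using d by (simp_all add: borel_prod)
    have P': "?P = distr K (borel \<Otimes>\<^sub>M borel) (\<lambda>z. (fst (a z), snd (c z)))" by (simp add: borel_prod)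
    have "(\<integral>z. (norm (?T (fst z) - snd z))\<^sup>2 \<partial>?P) \<le> lam * ((\<integral>z. (norm (fst z - snd z))\<^sup>2 \<partial>?P) - ?W\<^sup>2)"
      by (rule gradient_plan_stability(2)[OF lam convex smooth \<mu> \<nu> push P])
    also have "\<dots> \<le> lam * ((A + B + (A + B + ?W) + 2 * e)\<^sup>2 - ?W\<^sup>2)"
      using P_le lam by (intro mult_left_mono diff_right_mono) (auto simp: L2_le_def)
    \<comment> \<open>The difference of squares (W + 2 s)^2 - W^2 with s =
      \<open>A + B + e\<close>.\<close>
    also have "\<dots> = 4 * (lam * (A + B + e) * (?W + (A + B + e)))"
      by (simp add: power2_eq_square algebra_simps)
    finally have "sqrt (\<integral>z. (norm (?T (fst z) - snd z))\<^sup>2 \<partial>?P) \<le> sqrt (4 * (lam * (A + B + e) * (?W + (A + B + e))))"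
      by (rule real_sqrt_le_mono)
    also have "\<dots> = 2 * sqrt lam * sqrt (A + B + e) * sqrt (?W + (A + B + e))"
      by (simp only: real_sqrt_mult real_sqrt_four mult.assoc)
    finally have "sqrt (\<integral>z. (norm (?T (fst z) - snd z))\<^sup>2 \<partial>?P) \<le> 2 * sqrt lam * sqrt (A + B + e) * sqrt (?W + (A + B + e))" .
    moreover have "L2_le ?P (\<lambda>z. norm (?T (fst z) - snd z)) (sqrt (\<integral>z. (norm (?T (fst z) - snd z))\<^sup>2 \<partial>?P))"
      using gradient_plan_stability(1)[OF lam convex smooth \<mu> \<nu> push P]
      by (intro L2_le_sqrt) (simp_all add: P')
    ultimately have "L2_le ?P (\<lambda>z. norm (?T (fst z) - snd z)) (2 * sqrt lam * sqrt (A + B + e) * sqrt (?W + (A + B + e)))"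
      by (rule L2_le_weaken[rotated])
    then have "L2_le K (\<lambda>z. norm (?T (fst (a z)) - snd (c z))) (2 * sqrt lam * sqrt (A + B + e) * sqrt (?W + (A + B + e)))"
      unfolding P' by (subst (asm) L2_le_distr) simp_all
    moreover have "L2_le K (\<lambda>z. norm (fst (a z) - snd (a z))) A" "L2_le K (\<lambda>z. norm (fst (c z) - snd (c z))) B"
      using bounds unfolding d' by (simp_all add: L2_le_distr)
    ultimately have "L2_le K (\<lambda>z. norm (?T (fst (a z)) - snd (c z)) + lam * norm (fst (a z) - snd (a z))
        + norm (fst (c z) - snd (c z)) + lam * e + e) (R e)"
      unfolding R_def using lam \<open>e > 0\<close> K by (intro L2_le_add L2_le_cmult L2_le_const) auto
    then have "L2_le K (\<lambda>z. norm (?T (fst (b z)) - snd (b z))) (R e)"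
    proof (rule L2_le_mono)
      show "AE z in K. \<bar>norm (?T (fst (b z)) - snd (b z))\<bar> \<le> \<bar>norm (?T (fst (a z)) - snd (c z))
          + lam * norm (fst (a z) - snd (a z)) + norm (fst (c z) - snd (c z)) + lam * e + e\<bar>"
        using ae
      proof eventually_elim
        case (elim z)
        \<comment> \<open>The path crosses the joint at \<mu>', follows \<alpha> backwards under the
          gradient, takes the stable pair of outer variables, follows \<beta> backwards and crosses
          the joint at \<nu>'. The Lipschitz bound handles the first two legs.\<close>
        have "dist (?T (fst (b z))) (snd (b z)) \<le> dist (?T (fst (b z))) (?T (snd (a z))) + dist (?T (snd (a z))) (?T (fst (a z)))
            + dist (?T (fst (a z))) (snd (c z)) + dist (snd (c z)) (fst (c z)) + dist (fst (c z)) (snd (b z))"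
          using dist_triangle[of "?T (fst (b z))" "snd (b z)" "?T (snd (a z))"] dist_triangle[of "?T (snd (a z))" "snd (b z)" "?T (fst (a z))"]
            dist_triangle[of "?T (fst (a z))" "snd (b z)" "snd (c z)"] dist_triangle[of "snd (c z)" "snd (b z)" "fst (c z)"] by linarith
        moreover have "dist (?T (fst (b z))) (?T (snd (a z))) \<le> lam * e"
        proof -
          have "dist (?T (fst (b z))) (?T (snd (a z))) \<le> lam * norm (fst (b z) - snd (a z))"
            unfolding dist_norm by (rule gradient_lipschitz[OF lam convex smooth])
          also have "\<dots> \<le> lam * e"
            using elim(1) lam by (intro mult_left_mono) (simp_all add: norm_minus_commute)
          finally show ?thesis .
        qed
        moreover have "dist (?T (snd (a z))) (?T (fst (a z))) \<le> lam * norm (fst (a z) - snd (a z))"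
          using gradient_lipschitz[OF lam convex smooth, of "snd (a z)" "fst (a z)"]
          by (simp add: dist_norm norm_minus_commute)
        ultimately show ?case using elim(2) by (simp add: dist_norm norm_minus_commute)
      qed
    qed measurable
    then show ?thesis unfolding d' by (subst L2_le_distr) simp_all
  qed
  \<comment> \<open>\<gamma> itself does not depend on \<open>e\<close>, so the bound survives the
    limit by continuity of \<open>R\<close> at 0.\<close>
  have "(R \<longlongrightarrow> R 0) (at_right 0)"
    unfolding R_def by (auto intro!: tendsto_eq_intros)
  moreover have "\<forall>\<^sub>F e in at_right (0::real). sqrt (\<integral>z. (norm (?T (fst z) - snd z))\<^sup>2 \<partial>\<gamma>) \<le> R e"
    unfolding eventually_at_right_field using L2_le_imp_sqrt_le[OF approx] by (intro exI[of _ 1]) auto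
  ultimately have "sqrt (\<integral>z. (norm (?T (fst z) - snd z))\<^sup>2 \<partial>\<gamma>) \<le> R 0"
    by (rule tendsto_lowerbound) simp
  moreover have "L2_le \<gamma> (\<lambda>z. norm (?T (fst z) - snd z)) (sqrt (\<integral>z. (norm (?T (fst z) - snd z))\<^sup>2 \<partial>\<gamma>))"
    using approx[of 1] by (intro L2_le_sqrt) (auto simp: L2_le_def)
  ultimately show ?thesis by (auto simp: R_def intro: L2_le_weaken)
qed

section \<open>Restriction to the sets carrying the marginals, and the final estimate\<close>

lemma set_integral_full_measure:
  fixes f :: "'m \<Rightarrow> real"
  assumes "A \<in> sets M" "AE x in M. x \<in> A" "f \<in> borel_measurable M"
  shows "set_integrable M A f \<longleftrightarrow> integrable M f" "set_lebesgue_integral M A f = integral\<^sup>L M f"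
proof -
  have ae: "AE x in M. indicator A x *\<^sub>R f x = f x" using assms(2) by eventually_elim simp
  show "set_integrable M A f \<longleftrightarrow> integrable M f"
    unfolding set_integrable_def by (rule integrable_cong_AE[OF _ _ ae]) (use assms in auto)
  show "set_lebesgue_integral M A f = integral\<^sup>L M f"
    unfolding set_lebesgue_integral_def by (rule integral_cong_AE[OF _ _ ae]) (use assms in auto)
qed

lemma transport_plan_AE_Times:
  assumes \<gamma>: "\<gamma> \<in> transport_plans \<mu> \<nu>" and "AE x in \<mu>. x \<in> X" "AE y in \<nu>. y \<in> Y"
  shows "AE z in \<gamma>. z \<in> X \<times> Y"
proof -
  note [measurable_cong] = transport_plan_distr(2)[OF \<gamma>]
  have fs: "fst \<in> measurable \<gamma> borel" "snd \<in> measurable \<gamma> borel" by measurable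
  have "AE z in \<gamma>. fst z \<in> X" "AE z in \<gamma>. snd z \<in> Y"
    using AE_distrD[OF fs(1), of "\<lambda>x. x \<in> X"] AE_distrD[OF fs(2), of "\<lambda>y. y \<in> Y"] assms(2,3)
    by (simp_all only: transport_plan_distr(3,4)[OF \<gamma>])
  then show ?thesis by eventually_elim (auto simp: mem_Times_iff)
qed

text \<open>The integrability conjunct rules out that the inequality holds only because a divergent
  Bochner integral is read as 0.\<close>

theorem theorem3p5:
  fixes lam :: real
    and \<mu> \<nu> \<mu>h \<nu>h :: "'a::euclidean_space measure"
    and \<phi> :: "'a \<Rightarrow> real" and T :: "'a \<Rightarrow> 'a"
    and X Y :: "'a set"
    and \<alpha>h \<beta>h \<gamma>h :: "('a \<times> 'a) measure"
    and e\<alpha> e\<beta> eh :: real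
  assumes "lam > 0"
    and "\<mu> \<in> P2" and "\<nu> \<in> P2"
    and "regular lam \<mu> \<nu> \<phi>" and "T = gradient \<phi>"
    and "\<mu>h \<in> P2" and "\<nu>h \<in> P2"
    and "X \<in> sets borel" and "Y \<in> sets borel"
    and "AE x in \<mu>. x \<in> X" and "AE x in \<mu>h. x \<in> X"
    and "AE y in \<nu>. y \<in> Y" and "AE y in \<nu>h. y \<in> Y"
    and "\<alpha>h \<in> transport_plans \<mu> \<mu>h"
    and "\<beta>h \<in> transport_plans \<nu>h \<nu>"
    and "e\<alpha> = sqrt (set_lebesgue_integral \<alpha>h (X \<times> X) (\<lambda>(x, x'). (norm (x - x'))\<^sup>2))"
    and "e\<beta> = sqrt (set_lebesgue_integral \<beta>h (Y \<times> Y) (\<lambda>(y', y). (norm (y' - y))\<^sup>2))"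
    and "eh = e\<alpha> + e\<beta>"
    and "optimal_plan \<mu>h \<nu>h \<gamma>h"
  shows "set_integrable \<gamma>h (X \<times> Y) (\<lambda>(x', y'). (norm (T x' - y'))\<^sup>2) \<and>
    sqrt (set_lebesgue_integral \<gamma>h (X \<times> Y) (\<lambda>(x', y'). (norm (T x' - y'))\<^sup>2))
      \<le> 2 * sqrt lam * sqrt eh * sqrt (W2 \<mu> \<nu> + eh) + lam * e\<alpha> + e\<beta>"
proof -
  have convex: "convex_on UNIV \<phi>" and smooth: "smooth_with lam \<phi>" and push: "distr \<mu> borel (gradient \<phi>) = \<nu>"
    using \<open>regular lam \<mu> \<nu> \<phi>\<close> by (auto simp: regular_def optimal_map_def)
  have \<gamma>: "\<gamma>h \<in> transport_plans \<mu>h \<nu>h" using \<open>optimal_plan \<mu>h \<nu>h \<gamma>h\<close> by (simp add: optimal_plan_def)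
  note [measurable_cong] = transport_plan_distr(2)[OF \<open>\<alpha>h \<in> transport_plans \<mu> \<mu>h\<close>]
    transport_plan_distr(2)[OF \<open>\<beta>h \<in> transport_plans \<nu>h \<nu>\<close>] transport_plan_distr(2)[OF \<gamma>]
  note [measurable] = \<open>X \<in> sets borel\<close> \<open>Y \<in> sets borel\<close>
  \<comment> \<open>Both marginals are concentrated on \<open>X\<close>, so
    \<open>X \<times> X\<close> has full measure and the restricted integral defining
    \<open>e\<alpha>\<close> is the whole cost; likewise for \<open>e\<beta>\<close>.\<close>
  have "L2_le \<alpha>h (\<lambda>z. norm (fst z - snd z)) e\<alpha>"
    using L2_le_transport_plan[OF \<open>\<alpha>h \<in> _\<close> \<open>\<mu> \<in> P2\<close> \<open>\<mu>h \<in> P2\<close>] unfolding \<open>e\<alpha> = _\<close> split_def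
    by (subst set_integral_full_measure(2)) (use assms in \<open>auto intro!: transport_plan_AE_Times\<close>)
  moreover have "L2_le \<beta>h (\<lambda>z. norm (fst z - snd z)) e\<beta>"
    using L2_le_transport_plan[OF \<open>\<beta>h \<in> _\<close> \<open>\<nu>h \<in> P2\<close> \<open>\<nu> \<in> P2\<close>] unfolding \<open>e\<beta> = _\<close> split_def
    by (subst set_integral_full_measure(2)) (use assms in \<open>auto intro!: transport_plan_AE_Times\<close>)
  ultimately have "L2_le \<gamma>h (\<lambda>z. norm (T (fst z) - snd z))
      (2 * sqrt lam * sqrt eh * sqrt (W2 \<mu> \<nu> + eh) + lam * e\<alpha> + e\<beta>)"
    unfolding \<open>T = _\<close> \<open>eh = _\<close> using assms push convex smooth by (intro gradient_plan_error) auto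
  then have "integrable \<gamma>h (\<lambda>z. (norm (T (fst z) - snd z))\<^sup>2)"
    "(\<lambda>z. (norm (T (fst z) - snd z))\<^sup>2) \<in> borel_measurable \<gamma>h"
    "sqrt (\<integral>z. (norm (T (fst z) - snd z))\<^sup>2 \<partial>\<gamma>h) \<le> 2 * sqrt lam * sqrt eh * sqrt (W2 \<mu> \<nu> + eh) + lam * e\<alpha> + e\<beta>"
    by (auto simp: L2_le_def intro: L2_le_imp_sqrt_le)
  moreover have "X \<times> Y \<in> sets \<gamma>h" by measurable
  moreover have "AE z in \<gamma>h. z \<in> X \<times> Y"
    using \<gamma> assms by (intro transport_plan_AE_Times)
  ultimately show ?thesis
    unfolding split_def by (simp add: set_integral_full_measure)
qed

end
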